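(* Let $G:X\to X^{\odot\star}$ be an admissible perturbation for $\{T_0(t)\}_{t\ge0}$ of class $C^k$ for some $k\ge1$, with $G(0)=0$. Let $L:=DG(0)$, let $R:=G-L$, and let $\{T(t)\}_{t\ge0}$ be the $\mathcal{C}_0$-semigroup obtained from $\{T_0(t)\}_{t\ge0}$ by perturbation with $L$. Given $0<t_e\le\infty$ and $\phi\in X$, a continuous function $u:[0,t_e)\to X$ satisfies $$u(t)=T_0(t)\phi+j^{-1}\int_0^tT_0^{\odot\star}(t-\tau)G(u(\tau))\,d\tau\qquad\text{for all }t\in[0,t_e)$$ if and only if it satisfies $$u(t)=T(t)\phi+j^{-1}\int_0^tT^{\odot\star}(t-\tau)R(u(\tau))\,d\tau\qquad\text{for all }t\in[0,t_e).$$
   Context: All vector spaces are real. For a Banach space $E$, $\langle x,x^\star\rangle:=x^\star(x)$. Let $\{T_0(t)\}_{t\ge 0}$ be a $\mathcal{C}_0$-semigroup on a Banach space $X$. $X^\odot:=\{x^\star\in X^\star: \lim_{t\downarrow 0}\|T_0(t)^\star x^\star-x^\star\|=0\}$ (closed subspace), $T_0^\odot(t):=T_0(t)^\star|_{X^\odot}$, $X^{\odot\star}:=(X^\odot)^\star$, $T_0^{\odot\star}(t):=(T_0^\odot(t))^\star$; $j:X\to X^{\odot\star}$, $\langle x^\odot,jx\rangle:=\langle x,x^\odot\rangle$, is injective with closed range $jX$, and $j^{-1}:jX\to X$. Sun-reflexivity is not assumed. Integrals of $X^{\odot\star}$-valued functions are weak$^\star$ integrals: $\langle x^\odot,\int q\,d\tau\rangle:=\int\langle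 x^\odot,q\rangle d\tau$. A closed subspace $\mathscr{X}_0\subseteq X^{\odot\star}$ is an admissible range for $\{T_0(t)\}$ if for some (equivalently, every) non-degenerate interval $J$, every norm-continuous $f:J\to\mathscr{X}_0$ and all $s\le t$ in $J$ one has $\int_s^tT_0^{\odot\star}(t-\tau)f(\tau)d\tau\in jX$. A continuous $G:X\to X^{\odot\star}$ is an admissible perturbation for $\{T_0(t)\}$ if it takes values in some admissible range for $\{T_0(t)\}$. The perturbed semigroup $\{T(t)\}_{t\ge0}$ is the unique $\mathcal{C}_0$-semigroup on $X$ with $T(t)x=T_0(t)x+j^{-1}\int_0^tT_0^{\odot\star}(t-\tau)LT(\tau)x\,d\tau$ for all $x\in X$, $t\ge0$. The sun dual of $X$ with respect to $\{T(t)\}$ equals $X^\odot$, so $T^{\odot\star}(t)$ acts on $X^{\odot\star}$; any admissible range for $\{T_0(t)\}$ in which $L$ takes its values is also an admissible range for $\{T(t)\}$, so that the integral in the second equation takes values in $jX$. *)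

theory Defs
  imports "HOL-Analysis.Analysis"
begin

section \<open>Duals of subspaces\<close>

text \<open>
  The dual of a subspace \<open>V\<close> that depends on term parameters (here: the sun dual of a
  given semigroup) cannot be a type. It is therefore realised as a set inside an ambient normed
  space: the functions \<open>f\<close> with \<open>\<bar>f x\<bar> \<le> K * norm x\<close> for some \<open>K\<close>, with norm
  \<open>SUP x. \<bar>f x\<bar> / norm x\<close>. A functional on \<open>V\<close> is represented by its extension by
  zero outside \<open>V\<close>; this is an isometric embedding of the dual of \<open>V\<close>.
\<close>

typedef (overloaded) 'e lbfun = "{f :: 'e::real_normed_vector \<Rightarrow> real. \<exists>K. \<forall>x. \<bar>f x\<bar> \<le> K * norm x}"
  morphisms lb_apply Lbfun
  by (rule exI[of _ "\<lambda>_. 0"]) (auto intro!: exI[of _ 0])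

setup_lifting type_definition_lbfun

lemma lbfun_eqI: "(\<And>x. lb_apply f x = lb_apply g x) \<Longrightarrow> f = g"
  by (metis ext lb_apply_inject)

lemma lb_apply_bound: "\<exists>K\<ge>0. \<forall>x. \<bar>lb_apply f x\<bar> \<le> K * norm x"
proof -
  obtain K where "\<forall>x. \<bar>lb_apply f x\<bar> \<le> K * norm x" using lb_apply[of f] by auto
  then have "\<forall>x. \<bar>lb_apply f x\<bar> \<le> \<bar>K\<bar> * norm x"
    by (meson abs_ge_self dual_order.trans mult_right_mono norm_ge_zero)
  then show ?thesis by (intro exI[of _ "\<bar>K\<bar>"]) auto
qed

instantiation lbfun :: (real_normed_vector) real_vector
begin

lift_definition zero_lbfun :: "'a lbfun" is "\<lambda>_. 0"
  by (auto intro!: exI[of _ 0])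

lift_definition plus_lbfun :: "'a lbfun \<Rightarrow> 'a lbfun \<Rightarrow> 'a lbfun" is "\<lambda>f g x. f x + g x"
proof -
  fix f g :: "'a \<Rightarrow> real"
  assume "\<exists>K. \<forall>x. \<bar>f x\<bar> \<le> K * norm x" "\<exists>K. \<forall>x. \<bar>g x\<bar> \<le> K * norm x"
  then obtain K L where "\<forall>x. \<bar>f x\<bar> \<le> K * norm x" "\<forall>x. \<bar>g x\<bar> \<le> L * norm x" by blast
  then have "\<bar>f x + g x\<bar> \<le> K * norm x + L * norm x" for x
    using abs_triangle_ineq[of "f x" "g x"] by (meson add_mono order_trans)
  then have "\<forall>x. \<bar>f x + g x\<bar> \<le> (K + L) * norm x" by (simp add: distrib_right)
  then show "\<exists>K. \<forall>x. \<bar>f x + g x\<bar> \<le> K * norm x" by blast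
qed

lift_definition uminus_lbfun :: "'a lbfun \<Rightarrow> 'a lbfun" is "\<lambda>f x. - f x"
  by simp

lift_definition minus_lbfun :: "'a lbfun \<Rightarrow> 'a lbfun \<Rightarrow> 'a lbfun" is "\<lambda>f g x. f x - g x"
proof -
  fix f g :: "'a \<Rightarrow> real"
  assume "\<exists>K. \<forall>x. \<bar>f x\<bar> \<le> K * norm x" "\<exists>K. \<forall>x. \<bar>g x\<bar> \<le> K * norm x"
  then obtain K L where "\<forall>x. \<bar>f x\<bar> \<le> K * norm x" "\<forall>x. \<bar>g x\<bar> \<le> L * norm x" by blast
  then have "\<bar>f x - g x\<bar> \<le> K * norm x + L * norm x" for x
    using abs_triangle_ineq4[of "f x" "g x"] by (meson add_mono order_trans)
  then have "\<forall>x. \<bar>f x - g x\<bar> \<le> (K + L) * norm x" by (simp add: distrib_right)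
  then show "\<exists>K. \<forall>x. \<bar>f x - g x\<bar> \<le> K * norm x" by blast
qed

lift_definition scaleR_lbfun :: "real \<Rightarrow> 'a lbfun \<Rightarrow> 'a lbfun" is "\<lambda>c f x. c * f x"
proof -
  fix c and f :: "'a \<Rightarrow> real"
  assume "\<exists>K. \<forall>x. \<bar>f x\<bar> \<le> K * norm x"
  then obtain K where "\<forall>x. \<bar>f x\<bar> \<le> K * norm x" by blast
  then have "\<forall>x. \<bar>c * f x\<bar> \<le> (\<bar>c\<bar> * K) * norm x"
    by (simp add: abs_mult mult.assoc mult_left_mono)
  then show "\<exists>K. \<forall>x. \<bar>c * f x\<bar> \<le> K * norm x" by blast
qed

instance
  by standard (transfer, simp add: algebra_simps)+

end

instantiation lbfun :: (real_normed_vector) real_normed_vector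
begin

definition norm_lbfun :: "'a lbfun \<Rightarrow> real"
  where "norm_lbfun f = (SUP x. \<bar>lb_apply f x\<bar> / norm x)"

definition dist_lbfun :: "'a lbfun \<Rightarrow> 'a lbfun \<Rightarrow> real"
  where "dist_lbfun f g = norm (f - g)"

definition sgn_lbfun :: "'a lbfun \<Rightarrow> 'a lbfun"
  where "sgn_lbfun f = scaleR (inverse (norm f)) f"

definition uniformity_lbfun :: "('a lbfun \<times> 'a lbfun) filter"
  where "uniformity_lbfun = (INF e\<in>{0<..}. principal {(f, g). dist f g < e})"

definition open_lbfun :: "'a lbfun set \<Rightarrow> bool"
  where "open_lbfun S = (\<forall>f\<in>S. \<forall>\<^sub>F (f', g) in uniformity. f' = f \<longrightarrow> g \<in> S)"

lemma lb_apply_bdd: "bdd_above (range (\<lambda>x. \<bar>lb_apply f x\<bar> / norm x))"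
proof -
  obtain K where K: "K \<ge> 0" "\<And>x. \<bar>lb_apply f x\<bar> \<le> K * norm x" using lb_apply_bound by blast
  have "\<bar>lb_apply f x\<bar> / norm x \<le> K" for x
    using K by (cases "x = 0") (auto simp: divide_le_eq)
  then show ?thesis by (intro bdd_aboveI[of _ K]) auto
qed

lemma lb_apply_le_norm: "\<bar>lb_apply f x\<bar> \<le> norm f * norm x"
proof (cases "x = 0")
  case True
  then show ?thesis using lb_apply_bound[of f] by (metis norm_zero mult_zero_right)
next
  case False
  have "\<bar>lb_apply f x\<bar> / norm x \<le> norm f"
    unfolding norm_lbfun_def by (rule cSUP_upper[OF _ lb_apply_bdd]) simp
  then show ?thesis using False by (simp add: divide_le_eq)
qed

lemma norm_lbfun_le_iff: "norm f \<le> K \<longleftrightarrow> 0 \<le> K \<and> (\<forall>x. \<bar>lb_apply f x\<bar> \<le> K * norm x)"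
proof
  assume le: "norm f \<le> K"
  have "\<bar>lb_apply f 0\<bar> / norm (0::'a) \<le> norm f"
    unfolding norm_lbfun_def by (rule cSUP_upper[OF _ lb_apply_bdd]) simp
  then have "0 \<le> K" using le by simp
  moreover have "\<bar>lb_apply f x\<bar> \<le> K * norm x" for x
    using lb_apply_le_norm[of f x] le by (meson mult_right_mono norm_ge_zero order_trans)
  ultimately show "0 \<le> K \<and> (\<forall>x. \<bar>lb_apply f x\<bar> \<le> K * norm x)" by blast
next
  assume K: "0 \<le> K \<and> (\<forall>x. \<bar>lb_apply f x\<bar> \<le> K * norm x)"
  have "\<bar>lb_apply f x\<bar> / norm x \<le> K" for x
    using K by (cases "x = 0") (auto simp: divide_le_eq)
  then show "norm f \<le> K" unfolding norm_lbfun_def by (intro cSUP_least) auto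
qed

instance
proof
  fix f g :: "'a lbfun" and a :: real
  show "dist f g = norm (f - g)" by (rule dist_lbfun_def)
  show "sgn f = f /\<^sub>R norm f" by (rule sgn_lbfun_def)
  show "uniformity = (INF e\<in>{0<..}. principal {(x::'a lbfun, y). dist x y < e})"
    by (rule uniformity_lbfun_def)
  show "open U = (\<forall>x\<in>U. \<forall>\<^sub>F (x', y) in uniformity. x' = x \<longrightarrow> y \<in> U)" for U :: "'a lbfun set"
    by (rule open_lbfun_def)
  show "(norm f = 0) = (f = 0)"
  proof
    assume "norm f = 0"
    then have "lb_apply f x = 0" for x using lb_apply_le_norm[of f x] by simp
    then show "f = 0" by (intro lbfun_eqI) (simp add: zero_lbfun.rep_eq)
  next
    assume "f = 0"
    then have "norm f \<le> 0" by (simp add: norm_lbfun_le_iff zero_lbfun.rep_eq)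
    moreover have "0 \<le> norm f" using norm_lbfun_le_iff[of f "norm f"] by simp
    ultimately show "norm f = 0" by simp
  qed
  have pos: "0 \<le> norm f" for f :: "'a lbfun" using norm_lbfun_le_iff[of f "norm f"] by simp
  have "\<bar>lb_apply (f + g) x\<bar> \<le> (norm f + norm g) * norm x" for x
    using lb_apply_le_norm[of f x] lb_apply_le_norm[of g x]
    by (simp add: plus_lbfun.rep_eq distrib_right)
  then show "norm (f + g) \<le> norm f + norm g"
    using pos by (simp add: norm_lbfun_le_iff)
  have le: "norm (a *\<^sub>R f) \<le> \<bar>a\<bar> * norm f" for a and f :: "'a lbfun"
    using pos lb_apply_le_norm[of f]
    by (auto simp: norm_lbfun_le_iff scaleR_lbfun.rep_eq abs_mult mult.assoc intro!: mult_left_mono)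
  show "norm (a *\<^sub>R f) = \<bar>a\<bar> * norm f"
  proof (cases "a = 0")
    case True
    then show ?thesis using le[of a f] pos[of "a *\<^sub>R f"] by simp
  next
    case False
    have "inverse a *\<^sub>R a *\<^sub>R f = f" using False by simp
    then have "norm f \<le> \<bar>inverse a\<bar> * norm (a *\<^sub>R f)" using le[of "inverse a" "a *\<^sub>R f"] by simp
    then have "\<bar>a\<bar> * norm f \<le> norm (a *\<^sub>R f)" using False
      by (simp add: abs_inverse field_simps)
    then show ?thesis using le[of a f] by simp
  qed
qed

end

definition dual_on :: "'e::real_normed_vector set \<Rightarrow> 'e lbfun set"
  where "dual_on V = {f. (\<forall>x\<in>V. \<forall>y\<in>V. lb_apply f (x + y) = lb_apply f x + lb_apply f y) \<and>
                         (\<forall>c. \<forall>x\<in>V. lb_apply f (c *\<^sub>R x) = c * lb_apply f x) \<and>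
                         (\<forall>x. x \<notin> V \<longrightarrow> lb_apply f x = 0)}"


section \<open>Maps of class C^k between normed spaces\<close>

definition bounded_multilinear :: "nat \<Rightarrow> ('a::real_normed_vector list \<Rightarrow> 'b::real_normed_vector) \<Rightarrow> bool"
  where "bounded_multilinear n A \<longleftrightarrow>
    (\<forall>vs i. length vs = n \<longrightarrow> i < n \<longrightarrow> linear (\<lambda>v. A (vs[i := v]))) \<and>
    (\<exists>K. \<forall>vs. length vs = n \<longrightarrow> norm (A vs) \<le> K * prod_list (map norm vs))"

text \<open>
  The iterated spaces \<open>L(X, L(X, \<dots>))\<close> in which the successive Frechet derivatives live have a
  type depending on the order, so the \<open>n\<close>-th derivative \<open>D n x\<close> is given as a bounded
  \<open>n\<close>-linear map, acting on lists of length \<open>n\<close>; the last two clauses say that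
  \<open>D (Suc n)\<close> is the Frechet derivative of \<open>D n\<close> and that \<open>D k\<close> is continuous, both with
  respect to the operator norm of multilinear maps.
\<close>

definition class_Ck :: "nat \<Rightarrow> ('a::real_normed_vector \<Rightarrow> 'b::real_normed_vector) \<Rightarrow> bool"
  where "class_Ck k f \<longleftrightarrow> (\<exists>D :: nat \<Rightarrow> 'a \<Rightarrow> 'a list \<Rightarrow> 'b.
    (\<forall>x. D 0 x [] = f x) \<and>
    (\<forall>n\<le>k. \<forall>x. bounded_multilinear n (D n x)) \<and>
    (\<forall>n<k. \<forall>x. \<forall>e>0. \<exists>d>0. \<forall>h. norm h < d \<longrightarrow> (\<forall>vs. length vs = n \<longrightarrow>
       norm (D n (x + h) vs - D n x vs - D (Suc n) x (h # vs)) \<le> e * norm h * prod_list (map norm vs))) \<and>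
    (\<forall>x. \<forall>e>0. \<exists>d>0. \<forall>h. norm h < d \<longrightarrow> (\<forall>vs. length vs = k \<longrightarrow>
       norm (D k (x + h) vs - D k x vs) \<le> e * prod_list (map norm vs))))"

lemma class_C0_iff: "class_Ck 0 f \<longleftrightarrow> continuous_on UNIV f"
proof
  assume "class_Ck 0 f"
  then obtain D where D: "\<forall>x. D 0 x [] = f x"
    "\<forall>x. \<forall>e>0. \<exists>d>0. \<forall>h. norm h < d \<longrightarrow> (\<forall>vs. length vs = 0 \<longrightarrow>
       norm (D (0::nat) (x + h) vs - D 0 x vs) \<le> e * prod_list (map norm vs))"
    unfolding class_Ck_def by auto
  show "continuous_on UNIV f"
    unfolding continuous_on_iff
  proof (intro ballI allI impI)
    fix x and e :: real assume "e > 0"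
    then obtain d where d: "d > 0" "\<forall>h. norm h < d \<longrightarrow> norm (f (x + h) - f x) \<le> e / 2"
      using D(2)[rule_format, of "e / 2" x] D(1) by auto
    have "dist (f y) (f x) < e" if "dist y x < d" for y
      using d(2)[rule_format, of "y - x"] that \<open>e > 0\<close> by (simp add: dist_norm)
    then show "\<exists>d>0. \<forall>y\<in>UNIV. dist y x < d \<longrightarrow> dist (f y) (f x) < e" using d(1) by blast
  qed
next
  assume c: "continuous_on UNIV f"
  have "\<exists>d>0. \<forall>h. norm h < d \<longrightarrow> norm (f (x + h) - f x) \<le> e" if "e > 0" for x and e :: real
  proof -
    have "\<exists>d>0. \<forall>y. dist y x < d \<longrightarrow> dist (f y) (f x) < e"
      using c \<open>e > 0\<close> unfolding continuous_on_iff by simp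
    then obtain d where "d > 0" "\<forall>y. dist y x < d \<longrightarrow> dist (f y) (f x) < e" by blast
    then have "norm h < d \<longrightarrow> norm (f (x + h) - f x) \<le> e" for h
      by (metis add_diff_cancel_left' dist_norm less_imp_le)
    then show ?thesis using \<open>d > 0\<close> by blast
  qed
  moreover have "\<exists>K. norm (f x) \<le> K" for x by blast
  ultimately show "class_Ck 0 f"
    unfolding class_Ck_def bounded_multilinear_def
    by (intro exI[of _ "\<lambda>_ x _. f x"]) simp
qed

lemma class_C1_iff:
  fixes f :: "'a::real_normed_vector \<Rightarrow> 'b::real_normed_vector"
  shows "class_Ck 1 f \<longleftrightarrow>
    (\<exists>f' :: 'a \<Rightarrow> 'a \<Rightarrow>\<^sub>L 'b. (\<forall>x. (f has_derivative blinfun_apply (f' x)) (at x)) \<and> continuous_on UNIV f')"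
proof
  assume "class_Ck 1 f"
  then obtain D where D0: "\<forall>x. D 0 x [] = f x"
    and ml: "\<forall>n\<le>1. \<forall>x. bounded_multilinear n (D n x)"
    and der0: "\<forall>n<1. \<forall>x. \<forall>e>0. \<exists>d>0. \<forall>h. norm h < d \<longrightarrow> (\<forall>vs. length vs = n \<longrightarrow>
       norm (D n (x + h) vs - D n x vs - D (Suc n) x (h # vs)) \<le> e * norm h * prod_list (map norm vs))"
    and cont: "\<forall>x. \<forall>e>0. \<exists>d>0. \<forall>h. norm h < d \<longrightarrow>
         (\<forall>vs. length vs = 1 \<longrightarrow> norm (D (1::nat) (x + h) vs - D 1 x vs) \<le> e * prod_list (map norm vs))"
    unfolding class_Ck_def by - (elim exE conjE, rule that, assumption+)
  have der: "\<exists>d>0. \<forall>h. norm h < d \<longrightarrow> norm (f (x + h) - f x - D 1 x [h]) \<le> e * norm h" if "e > 0" for x and e :: real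
    using der0[rule_format, of 0 e x] that D0 by simp
  have bl: "bounded_linear (\<lambda>v. D 1 x [v])" for x
  proof -
    have m: "bounded_multilinear 1 (D 1 x)" using ml by simp
    obtain K where K: "\<forall>vs. length vs = 1 \<longrightarrow> norm (D 1 x vs) \<le> K * prod_list (map norm vs)"
      using m unfolding bounded_multilinear_def by auto
    have lin: "linear (\<lambda>v. D 1 x ([0][0 := v]))"
      using conjunct1[OF m[unfolded bounded_multilinear_def], rule_format, of "[0]" 0] by simp
    have "norm (D 1 x [v]) \<le> norm v * K" for v
      using K[rule_format, of "[v]"] by (simp add: mult.commute)
    then show ?thesis using lin by (simp add: bounded_linear_def bounded_linear_axioms_def) blast
  qed
  define f' where "f' x = Blinfun (\<lambda>v. D 1 x [v])" for x
  have f': "blinfun_apply (f' x) v = D 1 x [v]" for x v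
    unfolding f'_def by (subst bounded_linear_Blinfun_apply[OF bl]) (rule refl)
  have "(f has_derivative blinfun_apply (f' x)) (at x)" for x
    unfolding has_derivative_at_alt
  proof (intro conjI allI impI)
    show "bounded_linear (blinfun_apply (f' x))" by (rule blinfun.bounded_linear_right)
    fix e :: real assume "e > 0"
    then obtain d where "d > 0" "\<forall>h. norm h < d \<longrightarrow> norm (f (x + h) - f x - D 1 x [h]) \<le> e * norm h"
      using der by blast
    then have "norm (f y - f x - blinfun_apply (f' x) (y - x)) \<le> e * norm (y - x)" if "norm (y - x) < d" for y
      using that by (auto simp: f' dest!: spec[of _ "y - x"])
    then show "\<exists>d>0. \<forall>y. norm (y - x) < d \<longrightarrow> norm (f y - f x - blinfun_apply (f' x) (y - x)) \<le> e * norm (y - x)"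
      using \<open>d > 0\<close> by blast
  qed
  moreover have "continuous_on UNIV f'"
    unfolding continuous_on_iff
  proof (intro ballI allI impI)
    fix x and e :: real assume e: "e > 0"
    obtain d where d: "d > 0" "\<forall>h. norm h < d \<longrightarrow>
         (\<forall>vs. length vs = 1 \<longrightarrow> norm (D 1 (x + h) vs - D 1 x vs) \<le> e / 2 * prod_list (map norm vs))"
      using cont[rule_format, of "e / 2" x] e by auto
    have "dist (f' y) (f' x) < e" if "dist y x < d" for y
    proof -
      have "norm (D 1 y [v] - D 1 x [v]) \<le> e / 2 * norm v" for v
        using d(2)[rule_format, of "y - x" "[v]"] that by (simp add: dist_norm)
      then have "norm (f' y - f' x) \<le> e / 2"
        using e by (intro norm_blinfun_bound) (auto simp: blinfun.diff_left f')
      then show ?thesis using e by (simp add: dist_norm)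
    qed
    then show "\<exists>d>0. \<forall>y\<in>UNIV. dist y x < d \<longrightarrow> dist (f' y) (f' x) < e" using d(1) by blast
  qed
  ultimately show "\<exists>f'. (\<forall>x. (f has_derivative blinfun_apply (f' x)) (at x)) \<and> continuous_on UNIV f'"
    by blast
next
  assume "\<exists>f' :: 'a \<Rightarrow> 'a \<Rightarrow>\<^sub>L 'b. (\<forall>x. (f has_derivative blinfun_apply (f' x)) (at x)) \<and> continuous_on UNIV f'"
  then obtain f' :: "'a \<Rightarrow> 'a \<Rightarrow>\<^sub>L 'b"
    where der: "\<And>x. (f has_derivative blinfun_apply (f' x)) (at x)" and c: "continuous_on UNIV f'"
    by blast
  define D where "D n x vs = (if n = 0 then f x else blinfun_apply (f' x) (hd vs))" for n :: nat and x vs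
  have "bounded_multilinear n (D n x)" if "n \<le> 1" for n x
  proof (cases "n = 0")
    case True
    then show ?thesis unfolding bounded_multilinear_def D_def by auto
  next
    case False
    then have n: "n = 1" using that by simp
    have "linear (blinfun_apply (f' x))" by (simp add: blinfun.bounded_linear_right bounded_linear.linear)
    have "linear (\<lambda>v. D 1 x (vs[i := v]))" if "length vs = 1" "i < 1" for vs i
      using that \<open>linear (blinfun_apply (f' x))\<close> by (cases vs) (auto simp: D_def)
    moreover have "norm (D 1 x vs) \<le> norm (f' x) * prod_list (map norm vs)" if "length vs = 1" for vs
      using that by (cases vs) (auto simp: D_def norm_blinfun)
    ultimately show ?thesis unfolding bounded_multilinear_def n by blast
  qed
  moreover have "\<exists>d>0. \<forall>h. norm h < d \<longrightarrow> norm (f (x + h) - f x - blinfun_apply (f' x) h) \<le> e * norm h"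
    if "e > 0" for x and e :: real
  proof -
    obtain d where "d > 0"
      "\<forall>y. norm (y - x) < d \<longrightarrow> norm (f y - f x - blinfun_apply (f' x) (y - x)) \<le> e * norm (y - x)"
      using der[of x] \<open>e > 0\<close> unfolding has_derivative_at_alt by blast
    then have "norm (f (x + h) - f x - blinfun_apply (f' x) h) \<le> e * norm h" if "norm h < d" for h
      using that by (auto dest!: spec[of _ "x + h"])
    then show ?thesis using \<open>d > 0\<close> by blast
  qed
  moreover have "\<exists>d>0. \<forall>h. norm h < d \<longrightarrow> (\<forall>vs. length vs = 1 \<longrightarrow>
       norm (D 1 (x + h) vs - D 1 x vs) \<le> e * prod_list (map norm vs))" if "e > 0" for x and e :: real
  proof -
    have "\<exists>d>0. \<forall>y. dist y x < d \<longrightarrow> dist (f' y) (f' x) < e"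
      using c \<open>e > 0\<close> unfolding continuous_on_iff by simp
    then obtain d where d: "d > 0" "\<forall>y. dist y x < d \<longrightarrow> dist (f' y) (f' x) < e" by blast
    have "norm (D 1 (x + h) vs - D 1 x vs) \<le> e * prod_list (map norm vs)"
      if "norm h < d" "length vs = 1" for h vs
    proof -
      obtain v where vs: "vs = [v]" using \<open>length vs = 1\<close> by (cases vs) auto
      have "norm (f' (x + h) - f' x) \<le> e"
        using d(2)[rule_format, of "x + h"] \<open>norm h < d\<close> by (simp add: dist_norm)
      then have "norm (blinfun_apply (f' (x + h) - f' x) v) \<le> e * norm v"
        by (meson mult_right_mono norm_blinfun norm_ge_zero order_trans)
      then show ?thesis by (simp add: D_def vs blinfun.diff_left)
    qed
    then show ?thesis using d(1) by blast
  qed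
  ultimately show "class_Ck 1 f"
    unfolding class_Ck_def by (intro exI[of _ D]) (auto simp: D_def)
qed


section \<open>Semigroups and sun duality\<close>

text \<open>
  Semigroups are functions on \<open>real\<close> of which only the values at \<open>t \<ge> 0\<close> matter. The adjoint
  of \<open>T t\<close> maps \<open>x'\<close> to \<open>x' o\<^sub>L T t\<close>.
\<close>

definition C0_semigroup :: "(real \<Rightarrow> 'a::real_normed_vector \<Rightarrow>\<^sub>L 'a) \<Rightarrow> bool"
  where "C0_semigroup T \<longleftrightarrow>
    T 0 = id_blinfun \<and>
    (\<forall>s\<ge>0. \<forall>t\<ge>0. T (s + t) = T s o\<^sub>L T t) \<and>
    (\<forall>x. ((\<lambda>t. blinfun_apply (T t) x) \<longlongrightarrow> x) (at_right 0))"

definition sun_dual :: "(real \<Rightarrow> 'a::real_normed_vector \<Rightarrow>\<^sub>L 'a) \<Rightarrow> ('a \<Rightarrow>\<^sub>L real) set"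
  where "sun_dual T = {x'. ((\<lambda>t. norm ((x' o\<^sub>L T t) - x')) \<longlongrightarrow> 0) (at_right 0)}"

definition sun_star_space :: "(real \<Rightarrow> 'a::real_normed_vector \<Rightarrow>\<^sub>L 'a) \<Rightarrow> ('a \<Rightarrow>\<^sub>L real) lbfun set"
  where "sun_star_space T = dual_on (sun_dual T)"

lift_definition sun_star :: "(real \<Rightarrow> 'a::real_normed_vector \<Rightarrow>\<^sub>L 'a) \<Rightarrow> real \<Rightarrow>
    ('a \<Rightarrow>\<^sub>L real) lbfun \<Rightarrow> ('a \<Rightarrow>\<^sub>L real) lbfun"
  is "\<lambda>T t f x'. if x' \<in> sun_dual T then f (x' o\<^sub>L T t) else 0"
proof -
  fix T :: "real \<Rightarrow> 'a \<Rightarrow>\<^sub>L 'a" and t and f :: "('a \<Rightarrow>\<^sub>L real) \<Rightarrow> real"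
  assume "\<exists>K. \<forall>x. \<bar>f x\<bar> \<le> K * norm x"
  then obtain K where K: "\<forall>x. \<bar>f x\<bar> \<le> K * norm x" by blast
  have "\<bar>f (x o\<^sub>L T t)\<bar> \<le> \<bar>K\<bar> * norm (T t) * norm x" for x
  proof -
    have "\<bar>f (x o\<^sub>L T t)\<bar> \<le> \<bar>K\<bar> * norm (x o\<^sub>L T t)"
      using K by (meson abs_ge_self mult_right_mono norm_ge_zero order_trans)
    also have "\<dots> \<le> \<bar>K\<bar> * (norm x * norm (T t))"
      by (intro mult_left_mono norm_blinfun_compose) simp
    finally show ?thesis by (simp add: mult_ac)
  qed
  then show "\<exists>K. \<forall>x. \<bar>if x \<in> sun_dual T then f (x o\<^sub>L T t) else 0\<bar> \<le> K * norm x"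
    by (intro exI[of _ "\<bar>K\<bar> * norm (T t)"]) auto
qed

lift_definition sun_embed :: "(real \<Rightarrow> 'a::real_normed_vector \<Rightarrow>\<^sub>L 'a) \<Rightarrow> 'a \<Rightarrow> ('a \<Rightarrow>\<^sub>L real) lbfun"
  is "\<lambda>T x x'. if x' \<in> sun_dual T then blinfun_apply x' x else 0"
proof -
  fix T :: "real \<Rightarrow> 'a \<Rightarrow>\<^sub>L 'a" and x :: 'a
  have "\<bar>blinfun_apply x' x\<bar> \<le> norm x * norm x'" for x' :: "'a \<Rightarrow>\<^sub>L real"
    using norm_blinfun[of x' x] by (simp add: mult.commute)
  then show "\<exists>K. \<forall>x'. \<bar>if x' \<in> sun_dual T then blinfun_apply x' x else 0\<bar> \<le> K * norm x'"
    by (intro exI[of _ "norm x"]) auto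
qed

text \<open>
  If the values of \<open>q\<close> vanish outside a set \<open>V\<close>, then so does the weak* integral; hence the
  definition needs no reference to the subspace on which the functionals live.
\<close>

definition weak_star_integral :: "real \<Rightarrow> real \<Rightarrow> (real \<Rightarrow> 'e::real_normed_vector lbfun) \<Rightarrow> 'e lbfun"
  where "weak_star_integral a b q = Lbfun (\<lambda>x. integral {a..b} (\<lambda>\<tau>. lb_apply (q \<tau>) x))"

definition admissible_range :: "(real \<Rightarrow> 'a::banach \<Rightarrow>\<^sub>L 'a) \<Rightarrow> ('a \<Rightarrow>\<^sub>L real) lbfun set \<Rightarrow> bool"
  where "admissible_range T \<X> \<longleftrightarrow>
    \<X> \<subseteq> sun_star_space T \<and> subspace \<X> \<and> closed \<X> \<and>
    (\<exists>J. is_interval J \<and> (\<exists>a\<in>J. \<exists>b\<in>J. a < b) \<and>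
      (\<forall>f. continuous_on J f \<longrightarrow> f ` J \<subseteq> \<X> \<longrightarrow>
        (\<forall>s\<in>J. \<forall>t\<in>J. s \<le> t \<longrightarrow>
          weak_star_integral s t (\<lambda>\<tau>. sun_star T (t - \<tau>) (f \<tau>)) \<in> range (sun_embed T))))"

definition admissible_perturbation ::
    "(real \<Rightarrow> 'a::banach \<Rightarrow>\<^sub>L 'a) \<Rightarrow> ('a \<Rightarrow> ('a \<Rightarrow>\<^sub>L real) lbfun) \<Rightarrow> bool"
  where "admissible_perturbation T G \<longleftrightarrow>
    continuous_on UNIV G \<and> (\<exists>\<X>. admissible_range T \<X> \<and> range G \<subseteq> \<X>)"

definition perturbed_semigroup ::
    "(real \<Rightarrow> 'a::banach \<Rightarrow>\<^sub>L 'a) \<Rightarrow> ('a \<Rightarrow> ('a \<Rightarrow>\<^sub>L real) lbfun) \<Rightarrow> (real \<Rightarrow> 'a \<Rightarrow>\<^sub>L 'a) \<Rightarrow> bool"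
  where "perturbed_semigroup T\<^sub>0 L T \<longleftrightarrow>
    C0_semigroup T \<and>
    (\<forall>x. \<forall>t\<ge>0. blinfun_apply (T t) x = blinfun_apply (T\<^sub>0 t) x +
       inv (sun_embed T\<^sub>0) (weak_star_integral 0 t (\<lambda>\<tau>. sun_star T\<^sub>0 (t - \<tau>) (L (blinfun_apply (T \<tau>) x)))))"

end

theory Submission
  imports Defs
begin

text \<open>
  Write \<open>j\<close> for the embedding of \<open>X\<close> into \<open>X\<^sup>\<odot>\<^sup>*\<close>. Being a solution on a compact interval
  is a local property: \<open>u\<close> solves the variation-of-constants equation of a semigroup \<open>S\<close> with
  forcing \<open>g\<close> if and only if \<open>u 0 = \<phi>\<close> and the defect
  \<open>j (u (s + h) - S h (u s)) - \<integral> S\<^sup>\<odot>\<^sup>*(s + h - \<tau>) (g \<tau>) d\<tau>\<close>, with the integral over \<open>{s..s + h}\<close>, is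
  \<open>O(h\<^sup>2)\<close> uniformly in \<open>s\<close> (lemma \<open>mild_solution_iff_small_defect\<close>). Indeed, transporting the
  defects to the final time with \<open>S\<close> turns them into increments of a scalar function, whose derivative
  is then zero. Now \<open>G = L + R\<close>, and the defect of \<open>u\<close> for \<open>T\<^sub>0\<close> with forcing \<open>L u + R u\<close> differs
  from its defect for \<open>T\<close> with forcing \<open>R u\<close> by \<open>O(h\<^sup>2)\<close>, as soon as one of them is small: the equation that defines \<open>T\<close> writes
  \<open>T h (u s) - T\<^sub>0 h (u s)\<close> as an integral of \<open>L (T \<tau> (u s))\<close>, which is \<open>O(\<tau>)\<close>-close to \<open>L (u (s + \<tau>))\<close>, and
  \<open>T \<sigma> - T\<^sub>0 \<sigma> = O(\<sigma>)\<close> allows exchanging the semigroups under the integral of \<open>R u\<close>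
  (lemma \<open>small_defect_perturbation_iff\<close>). So the two equations are equivalent, without any fixed
  point or Gronwall argument.

  The inverse of \<open>j\<close> is meaningful only on the range of \<open>j\<close>, so two further facts are needed. The
  embedding is injective, because the sun dual is norming up to a constant (lemma
  \<open>sun_dual_norming\<close>): averages of \<open>T\<^sub>0(s)\<^sup>* f\<close> over short times lie in the sun dual, and \<open>f\<close> can be
  chosen to norm a given vector. This also bounds norms in \<open>X\<close> by testing with the sun dual. The weak*
  integrals lie in the range of \<open>j\<close>, also with \<open>T\<close> in place of \<open>T\<^sub>0\<close>: a Riemann-type sum, exact
  for \<open>T\<^sub>0\<close> on each piece of a partition, converges in \<open>X\<close> to a vector representing the integral
  (lemma \<open>admissible_range_nearby_semigroup\<close>). Since \<open>\<parallel>T \<sigma> - T\<^sub>0 \<sigma>\<parallel> = O(\<sigma>)\<close>, the two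
  semigroups have the same sun dual.
\<close>

section \<open>Norming functionals\<close>

definition sublinear :: "('a::real_vector \<Rightarrow> real) \<Rightarrow> bool"
  where "sublinear p \<longleftrightarrow> (\<forall>x y. p (x + y) \<le> p x + p y) \<and> (\<forall>c\<ge>0. \<forall>x. p (c *\<^sub>R x) = c * p x)"

lemma sublinear_neg:
  assumes "sublinear p"
  shows "- p (- x) \<le> p x"
proof -
  have "p 0 = 0"
    using assms unfolding sublinear_def by (metis order_refl mult_zero_left scaleR_zero_left)
  moreover have "p (x + - x) \<le> p x + p (- x)"
    using assms unfolding sublinear_def by blast
  ultimately show ?thesis by simp
qed

text \<open>
  The purpose is to lower \<open>p\<close> without losing sublinearity, so that its value at \<open>- v\<close> drops to
  \<open>- p v\<close> or less. A minimal sublinear functional cannot be lowered; it is therefore odd, and an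
  odd sublinear functional is linear.
\<close>

definition tighten :: "('a::real_vector \<Rightarrow> real) \<Rightarrow> 'a \<Rightarrow> 'a \<Rightarrow> real"
  where "tighten p v y = (INF t\<in>{0..}. p (y + t *\<^sub>R v) - t * p v)"

context
  fixes p :: "'a::real_vector \<Rightarrow> real" and v :: 'a
  assumes p: "sublinear p"
begin

lemma tighten_lower: "t \<ge> 0 \<Longrightarrow> tighten p v y \<le> p (y + t *\<^sub>R v) - t * p v"
proof -
  have "- p (- y) \<le> p (y + t *\<^sub>R v) - t * p v" if "t \<ge> 0" for t
  proof -
    have "p (- y + (y + t *\<^sub>R v)) \<le> p (- y) + p (y + t *\<^sub>R v)"
      using p unfolding sublinear_def by blast
    moreover have "p (t *\<^sub>R v) = t * p v" using p that unfolding sublinear_def by blast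
    ultimately show ?thesis by simp
  qed
  then have "bdd_below ((\<lambda>t. p (y + t *\<^sub>R v) - t * p v) ` {0..})"
    by (intro bdd_belowI[of _ "- p (- y)"]) auto
  then show "t \<ge> 0 \<Longrightarrow> tighten p v y \<le> p (y + t *\<^sub>R v) - t * p v"
    unfolding tighten_def by (intro cINF_lower) auto
qed

lemma tighten_greatest:
  "(\<And>t. t \<ge> 0 \<Longrightarrow> c \<le> p (y + t *\<^sub>R v) - t * p v) \<Longrightarrow> c \<le> tighten p v y"
  unfolding tighten_def by (intro cINF_greatest) auto

lemma tighten_le: "tighten p v y \<le> p y"
  using tighten_lower[of 0 y] by simp

lemma tighten_neg: "tighten p v (- v) \<le> - p v"
proof -
  have "p 0 = 0"
    using p unfolding sublinear_def by (metis order_refl mult_zero_left scaleR_zero_left)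
  then show ?thesis using tighten_lower[of 1 "- v"] by simp
qed

lemma sublinear_tighten: "sublinear (tighten p v)"
proof -
  have add: "tighten p v (x + y) \<le> tighten p v x + tighten p v y" for x y
  proof -
    have "tighten p v (x + y) - tighten p v x \<le> p (y + t *\<^sub>R v) - t * p v" if t: "t \<ge> 0" for t
    proof -
      have "tighten p v (x + y) - (p (y + t *\<^sub>R v) - t * p v) \<le> p (x + s *\<^sub>R v) - s * p v"
        if s: "s \<ge> 0" for s
      proof -
        have "tighten p v (x + y) \<le> p (x + y + (s + t) *\<^sub>R v) - (s + t) * p v"
          using s t by (intro tighten_lower) simp
        moreover have "p ((x + s *\<^sub>R v) + (y + t *\<^sub>R v)) \<le> p (x + s *\<^sub>R v) + p (y + t *\<^sub>R v)"
          using p unfolding sublinear_def by blast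
        moreover have "(x + s *\<^sub>R v) + (y + t *\<^sub>R v) = x + y + (s + t) *\<^sub>R v"
          by (simp add: scaleR_add_left)
        ultimately show ?thesis by (simp add: algebra_simps)
      qed
      from tighten_greatest[OF this] show ?thesis by simp
    qed
    from tighten_greatest[OF this] show ?thesis by simp
  qed
  have scale_le: "tighten p v (c *\<^sub>R y) \<le> c * tighten p v y" if c: "c > 0" for c y
  proof -
    have "tighten p v (c *\<^sub>R y) / c \<le> p (y + t *\<^sub>R v) - t * p v" if t: "t \<ge> 0" for t
    proof -
      have "tighten p v (c *\<^sub>R y) \<le> p (c *\<^sub>R y + (c * t) *\<^sub>R v) - (c * t) * p v"
        using c t by (intro tighten_lower) simp
      also have "c *\<^sub>R y + (c * t) *\<^sub>R v = c *\<^sub>R (y + t *\<^sub>R v)"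
        by (simp add: scaleR_add_right)
      also have "p (c *\<^sub>R (y + t *\<^sub>R v)) = c * p (y + t *\<^sub>R v)"
        using p c unfolding sublinear_def by (meson less_imp_le)
      finally show ?thesis using c by (simp add: field_simps)
    qed
    from tighten_greatest[OF this] show ?thesis using c by (simp add: field_simps)
  qed
  have "tighten p v (c *\<^sub>R y) = c * tighten p v y" if "c \<ge> 0" for c y
  proof (cases "c = 0")
    case True
    have p0: "p (t *\<^sub>R v) = t * p v" if "t \<ge> 0" for t using p that unfolding sublinear_def by blast
    have "0 \<le> tighten p v 0" by (rule tighten_greatest) (simp add: p0)
    moreover have "tighten p v 0 \<le> 0" using tighten_lower[of 0 0] p0[of 0] by simp
    ultimately show ?thesis using True by simp
  next
    case False
    then have c: "c > 0" using that by simp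
    have "tighten p v (inverse c *\<^sub>R (c *\<^sub>R y)) \<le> inverse c * tighten p v (c *\<^sub>R y)"
      using c by (intro scale_le) simp
    then have "c * tighten p v y \<le> tighten p v (c *\<^sub>R y)"
      using c by (simp add: field_simps)
    then show ?thesis using scale_le[OF c, of y] by simp
  qed
  with add show ?thesis unfolding sublinear_def by blast
qed

end

text \<open>
  The pointwise infimum of a chain of sublinear functionals is sublinear: of two members of the chain
  the smaller one bounds the value at \<open>x + y\<close>. It is finite because \<open>- q (- x)\<close> bounds every
  member from below at \<open>x\<close>. So Zorn's lemma applies.
\<close>

lemma minimal_sublinear:
  fixes q :: "'a::real_vector \<Rightarrow> real"
  assumes q: "sublinear q"
  obtains m where "sublinear m" "\<And>x. m x \<le> q x"
    "\<And>p. sublinear p \<Longrightarrow> (\<And>x. p x \<le> m x) \<Longrightarrow> p = m"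
proof -
  define A where "A = {p. sublinear p \<and> (\<forall>x. p x \<le> q x)}"
  define P where "P p p' \<longleftrightarrow> (\<forall>x. p' x \<le> p x)" for p p' :: "'a \<Rightarrow> real"
  have po: "partial_order_on A (relation_of P A)"
    unfolding partial_order_on_def preorder_on_def refl_on_def trans_def antisym_def
      relation_of_def P_def
    by (auto intro!: ext order_antisym intro: order_trans)
  have ch: "\<exists>u\<in>A. \<forall>a\<in>C. P a u" if C: "C \<in> Chains (relation_of P A)" for C
  proof (cases "C = {}")
    case True
    then show ?thesis using q by (auto simp: A_def intro!: bexI[of _ q])
  next
    case False
    have CA: "C \<subseteq> A" using C unfolding Chains_def relation_of_def by auto
    have tot: "P a b \<or> P b a" if "a \<in> C" "b \<in> C" for a b
      using C that unfolding Chains_def relation_of_def by auto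
    define u where "u x = (INF p\<in>C. p x)" for x
    have lower: "- q (- x) \<le> p x" if "p \<in> C" for p x
    proof -
      have "sublinear p" "p (- x) \<le> q (- x)" using that CA by (auto simp: A_def)
      then show ?thesis using sublinear_neg[of p x] by simp
    qed
    then have bdd: "bdd_below ((\<lambda>p. p x) ` C)" for x
      by (intro bdd_belowI[of _ "- q (- x)"]) auto
    have u_le: "u x \<le> p x" if "p \<in> C" for p x
      unfolding u_def using bdd that by (intro cINF_lower)
    have u_ge: "c \<le> u x" if "\<And>p. p \<in> C \<Longrightarrow> c \<le> p x" for c x
      unfolding u_def using False that by (intro cINF_greatest)
    have add: "u (x + y) \<le> u x + u y" for x y
    proof -
      have "u (x + y) - p y \<le> p' x" if "p \<in> C" "p' \<in> C" for p p'
      proof -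
        have sub: "r (x + y) \<le> r x + r y" if "r \<in> C" for r
          using that CA by (auto simp: A_def sublinear_def)
        show ?thesis
          using tot[OF that] u_le[OF that(1), of "x + y"] u_le[OF that(2), of "x + y"]
            sub[OF that(1)] sub[OF that(2)]
          unfolding P_def by (elim disjE) (auto dest: spec[of _ x] spec[of _ y])
      qed
      then have "u (x + y) - u x \<le> p y" if "p \<in> C" for p
        using u_ge[of "u (x + y) - p y" x] that by fastforce
      then have "u (x + y) - u x \<le> u y" by (rule u_ge)
      then show ?thesis by simp
    qed
    have "u (c *\<^sub>R x) = c * u x" if c: "c \<ge> 0" for c x
    proof -
      have hom: "p (c *\<^sub>R x) = c * p x" if "p \<in> C" for p
        using that CA c by (auto simp: A_def sublinear_def)
      show ?thesis
      proof (cases "c = 0")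
        case True
        obtain p0 where "p0 \<in> C" using False by blast
        then have "u 0 \<le> 0" using u_le[of p0 0] hom[of p0] True by simp
        moreover have "0 \<le> p 0" if "p \<in> C" for p using hom[OF that] True by simp
        then have "0 \<le> u 0" by (rule u_ge)
        ultimately show ?thesis using True by simp
      next
        case F: False
        then have c: "c > 0" using c by simp
        have "c * u x \<le> u (c *\<^sub>R x)"
          by (rule u_ge) (simp add: hom u_le c)
        moreover have "u (c *\<^sub>R x) / c \<le> u x"
        proof (rule u_ge)
          fix p assume "p \<in> C"
          then show "u (c *\<^sub>R x) / c \<le> p x"
            using u_le[of p "c *\<^sub>R x"] hom[of p] c by (simp add: field_simps)
        qed
        ultimately show ?thesis using c by (simp add: field_simps)
      qed
    qed
    with add have "sublinear u" unfolding sublinear_def by blast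
    moreover have "u x \<le> q x" for x
    proof -
      obtain p0 where "p0 \<in> C" using False by blast
      then show ?thesis using u_le[of p0 x] CA unfolding A_def by (force intro: order_trans)
    qed
    ultimately show ?thesis using u_le unfolding A_def P_def by blast
  qed
  obtain m where m: "m \<in> A" "\<forall>a\<in>A. P m a \<longrightarrow> a = m"
    using predicate_Zorn[OF po ch] by blast
  show ?thesis
  proof (rule that)
    show "sublinear m" "\<And>x. m x \<le> q x" using m by (auto simp: A_def)
    show "p = m" if "sublinear p" "\<And>x. p x \<le> m x" for p
    proof -
      have "p x \<le> q x" for x using that(2)[of x] m(1) unfolding A_def by (force intro: order_trans)
      then show ?thesis using m(2) that unfolding A_def P_def by blast
    qed
  qed
qed

text \<open>
  This case of the Hahn--Banach theorem follows by lowering the norm in the direction \<open>x\<close>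
  and then choosing a minimal sublinear functional below the result.
\<close>

lemma norming_functional_exists:
  fixes x :: "'a::real_normed_vector"
  obtains f :: "'a \<Rightarrow>\<^sub>L real" where "norm f \<le> 1" "f x = norm x"
proof -
  define q where "q = tighten (norm :: 'a \<Rightarrow> real) x"
  have n: "sublinear (norm :: 'a \<Rightarrow> real)" unfolding sublinear_def by (auto simp: norm_triangle_ineq)
  have "sublinear q" unfolding q_def by (rule sublinear_tighten[OF n])
  then obtain m where m: "sublinear m" "\<And>y. m y \<le> q y"
    "\<And>p. sublinear p \<Longrightarrow> (\<And>y. p y \<le> m y) \<Longrightarrow> p = m"
    by (rule minimal_sublinear) blast
  \<comment> \<open>Minimality forbids any further tightening, and this makes \<open>m\<close> odd.\<close>
  have "tighten m v = m" for v
    by (rule m(3)) (auto intro: sublinear_tighten tighten_le m(1))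
  then have "m (- v) \<le> - m v" for v using tighten_neg[OF m(1), of v] by simp
  then have odd: "m (- v) = - m v" for v using sublinear_neg[OF m(1), of v] by (smt (verit))
  have sub: "m (y + z) \<le> m y + m z" for y z using m(1) unfolding sublinear_def by blast
  have add: "m (y + z) = m y + m z" for y z
    using sub[of y z] sub[of "y + z" "- z"] odd[of z] by simp
  have pos: "m (c *\<^sub>R y) = c * m y" if "c \<ge> 0" for c y using m(1) that unfolding sublinear_def by blast
  have scale: "m (c *\<^sub>R y) = c * m y" for c y
    using pos[of c y] pos[of "- c" y] odd[of "c *\<^sub>R y"] by (cases "c \<ge> 0") auto
  have le: "m y \<le> norm y" for y
    using m(2)[of y] tighten_le[OF n, of x y] unfolding q_def by simp
  have abs: "\<bar>m y\<bar> \<le> norm y" for y using le[of y] le[of "- y"] odd[of y] by simp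
  have bl: "bounded_linear m"
    using add scale abs by (intro bounded_linear_intro[of _ 1]) auto
  have "m (- x) \<le> - norm x"
    using m(2)[of "- x"] tighten_neg[OF n, of x] unfolding q_def by simp
  then have "m x = norm x" using odd[of x] le[of x] by simp
  moreover have "norm (Blinfun m) \<le> 1"
    using abs by (intro norm_blinfun_bound) (auto simp: bounded_linear_Blinfun_apply[OF bl])
  ultimately show ?thesis
    using that[of "Blinfun m"] by (simp add: bounded_linear_Blinfun_apply[OF bl])
qed

section \<open>Bounds and continuity for strongly continuous semigroups\<close>

text \<open>
  By Baire's theorem one of the closed sets on which the family is bounded by \<open>n\<close> contains a
  ball; differences of its points bound the operators on all directions at once.
\<close>

lemma uniform_boundedness:
  fixes T :: "'i \<Rightarrow> 'a::banach \<Rightarrow>\<^sub>L 'b::real_normed_vector"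
  assumes pw: "\<And>x. \<exists>K. \<forall>i. norm (T i x) \<le> K"
  shows "\<exists>K. \<forall>i. norm (T i) \<le> K"
proof -
  define A where "A n = {x. \<forall>i. norm (T i x) \<le> real n}" for n
  have cl: "closed (A n)" for n
  proof -
    have "closed {x. norm (T i x) \<le> real n}" for i
      by (intro closed_Collect_le continuous_intros)
    moreover have "A n = (\<Inter>i. {x. norm (T i x) \<le> real n})" by (auto simp: A_def)
    ultimately show ?thesis by auto
  qed
  have "\<exists>n. x \<in> A n" for x
  proof -
    obtain K where K: "\<And>i. norm (T i x) \<le> K" using pw by blast
    obtain n where "K \<le> real n" using real_arch_simple by blast
    then have "x \<in> A n" using order_trans[OF K] unfolding A_def by blast
    then show ?thesis ..
  qed
  then have U: "\<Union> (range A) = UNIV" by blast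
  have "\<exists>n. interior (A n) \<noteq> {}"
  proof (rule ccontr)
    assume "\<not> ?thesis"
    then have e: "interior (A n) = {}" for n by blast
    have "Met_TC.mtopology interior_of \<Union> (range A) = {}"
    proof (rule Met_TC.metric_Baire_category_alt)
      show "Met_TC.mcomplete TYPE('a)" by (simp add: complete_UNIV)
      show "countable (range A)" by simp
      show "closedin Met_TC.mtopology V \<and> Met_TC.mtopology interior_of V = {}" if "V \<in> range A" for V
        using that cl e by (auto simp: interior_of_def interior_def)
    qed
    then show False using U by simp
  qed
  then obtain n x where "x \<in> interior (A n)" by blast
  then obtain e where e: "e > 0" "cball x e \<subseteq> A n"
    by (meson mem_interior_cball)
  have "norm (T i) \<le> 2 * real n / e" for i
  proof (rule norm_blinfun_bound)
    show "0 \<le> 2 * real n / e" using e by simp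
    fix v
    show "norm (T i v) \<le> 2 * real n / e * norm v"
    proof (cases "v = 0")
      case False
      define c where "c = e / norm v"
      have c: "c > 0" using e False by (simp add: c_def)
      have "x + c *\<^sub>R v \<in> A n" "x \<in> A n"
        using e False by (auto intro!: subsetD[OF e(2)] simp: c_def dist_norm)
      then have "norm (T i (x + c *\<^sub>R v)) \<le> real n" "norm (T i x) \<le> real n" by (auto simp: A_def)
      moreover have "T i (c *\<^sub>R v) = T i (x + c *\<^sub>R v) - T i x"
        by (simp add: blinfun.add_right)
      ultimately have "norm (T i (c *\<^sub>R v)) \<le> 2 * real n"
        by (smt (verit) norm_triangle_ineq4)
      then have "c * norm (T i v) \<le> 2 * real n" using c by (simp add: blinfun.scaleR_right)
      then show ?thesis using c e False by (simp add: c_def field_simps)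
    qed simp
  qed
  then show ?thesis by blast
qed

lemma C0_semigroup_add:
  "C0_semigroup T \<Longrightarrow> s \<ge> 0 \<Longrightarrow> t \<ge> 0 \<Longrightarrow> T (s + t) = T s o\<^sub>L T t"
  by (simp add: C0_semigroup_def)

lemma C0_semigroup_zero: "C0_semigroup T \<Longrightarrow> T 0 = id_blinfun"
  by (simp add: C0_semigroup_def)

text \<open>
  If the norms were unbounded near zero, they would blow up along a sequence \<open>t n\<close> tending to \<open>0\<close>,
  although \<open>T (t n) x\<close> converges for each \<open>x\<close>.
\<close>

lemma C0_semigroup_bounded_near_zero:
  fixes T :: "real \<Rightarrow> 'a::banach \<Rightarrow>\<^sub>L 'a"
  assumes T: "C0_semigroup T"
  shows "\<exists>d>0. \<exists>K. \<forall>t\<in>{0..d}. norm (T t) \<le> K"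
proof (rule ccontr)
  assume neg: "\<not> ?thesis"
  \<comment> \<open>The summand \<open>norm (T 0)\<close> keeps \<open>t\<close> away from \<open>0\<close>, as the limit is one-sided.\<close>
  have "\<exists>t. 0 \<le> t \<and> t \<le> 1 / real (Suc n) \<and> real n + norm (T 0) < norm (T t)" for n
  proof (rule ccontr)
    assume "\<not> ?thesis"
    then have "\<forall>t\<in>{0..1 / real (Suc n)}. norm (T t) \<le> real n + norm (T 0)" by force
    moreover have "1 / real (Suc n) > 0" by simp
    ultimately show False using neg by blast
  qed
  then obtain t where t: "\<And>n. 0 \<le> t n" "\<And>n. t n \<le> 1 / real (Suc n)"
    "\<And>n. real n + norm (T 0) < norm (T (t n))" by metis
  have tpos: "t n > 0" for n
    using t(1)[of n] t(3)[of n] by (cases "t n = 0") auto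
  have t0: "t \<longlonglongrightarrow> 0"
    using t(1,2) by (intro tendsto_sandwich[OF _ _ tendsto_const LIMSEQ_Suc[OF lim_inverse_n']]) auto
  then have t0': "filterlim t (at_right 0) sequentially"
    using tpos by (simp add: filterlim_at order_less_imp_not_eq2 eventually_sequentially)
  have "\<exists>K. \<forall>n. norm (T (t n) x) \<le> K" for x
  proof -
    have "((\<lambda>t. T t x) \<longlongrightarrow> x) (at_right 0)" using T by (simp add: C0_semigroup_def)
    then have "(\<lambda>n. T (t n) x) \<longlonglongrightarrow> x" by (rule filterlim_compose[OF _ t0'])
    then have "Bseq (\<lambda>n. T (t n) x)" by (rule convergent_imp_Bseq[OF convergentI])
    then show ?thesis unfolding Bseq_def by blast
  qed
  from uniform_boundedness[OF this] obtain K where K: "\<And>n. norm (T (t n)) \<le> K" by blast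
  obtain n where "K \<le> real n" using real_arch_simple by blast
  then show False using K[of n] t(3)[of n] by (smt (verit) norm_ge_zero)
qed

lemma C0_semigroup_bounded:
  fixes T :: "real \<Rightarrow> 'a::banach \<Rightarrow>\<^sub>L 'a"
  assumes T: "C0_semigroup T"
  obtains M where "M \<ge> 1" "\<And>t. 0 \<le> t \<Longrightarrow> t \<le> a \<Longrightarrow> norm (T t) \<le> M"
proof -
  obtain d K where d: "d > 0" "\<And>t. 0 \<le> t \<Longrightarrow> t \<le> d \<Longrightarrow> norm (T t) \<le> K"
    using C0_semigroup_bounded_near_zero[OF T] by (metis atLeastAtMost_iff)
  define K' where "K' = max K 1"
  have K': "K' \<ge> 1" "\<And>t. 0 \<le> t \<Longrightarrow> t \<le> d \<Longrightarrow> norm (T t) \<le> K'"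
    using d(2) by (auto simp: K'_def max.coboundedI1)
  have pow: "norm (T t) \<le> K' ^ Suc n" if "0 \<le> t" "t \<le> real (Suc n) * d" for n t
    using that
  proof (induction n arbitrary: t)
    case 0
    then show ?case using K' by simp
  next
    case (Suc n)
    show ?case
    proof (cases "t \<le> d")
      case True
      then have "norm (T t) \<le> K' ^ 1" using K'(2) Suc by simp
      also have "\<dots> \<le> K' ^ Suc (Suc n)" using K'(1) by (intro power_increasing) auto
      finally show ?thesis .
    next
      case False
      then have "T t = T d o\<^sub>L T (t - d)"
        using C0_semigroup_add[OF T, of d "t - d"] d(1) by simp
      then have "norm (T t) \<le> norm (T d) * norm (T (t - d))" by (simp add: norm_blinfun_compose)
      also have "\<dots> \<le> K' * K' ^ Suc n"
        using False d(1) Suc.prems K' by (intro mult_mono Suc.IH) (auto simp: algebra_simps)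
      finally show ?thesis by simp
    qed
  qed
  obtain n where "a / d \<le> real n" using real_arch_simple by blast
  then have "a \<le> real (Suc n) * d" using d(1) by (simp add: field_simps add_increasing)
  then show ?thesis
    using K'(1) pow[of _ n] by (intro that[of "K' ^ Suc n"] one_le_power) auto
qed

text \<open>
  The semigroup law reduces the difference of two points of an orbit to one close to time zero.
\<close>

lemma C0_semigroup_orbit_continuous:
  fixes T :: "real \<Rightarrow> 'a::banach \<Rightarrow>\<^sub>L 'a"
  assumes T: "C0_semigroup T"
  shows "continuous_on {0..} (\<lambda>t. T t x)"
  unfolding continuous_on_iff
proof (intro ballI allI impI)
  fix t e :: real assume t: "t \<in> {0..}" and e: "e > 0"
  obtain M where M: "M \<ge> 1" "\<And>s. 0 \<le> s \<Longrightarrow> s \<le> t + 1 \<Longrightarrow> norm (T s) \<le> M"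
    using C0_semigroup_bounded[OF T] by blast
  have "((\<lambda>t. T t x) \<longlongrightarrow> x) (at_right 0)" using T by (simp add: C0_semigroup_def)
  then have "\<forall>\<^sub>F h in at_right 0. dist (T h x) x < e / M"
    using e M(1) by (intro tendstoD) auto
  then obtain d where d: "d > 0" "\<And>h. 0 < h \<Longrightarrow> h < d \<Longrightarrow> norm (T h x - x) < e / M"
    unfolding eventually_at_right_field by (auto simp: dist_norm)
  have step: "norm (T (s + h) x - T s x) < e"
    if "0 \<le> s" "s \<le> t + 1" "0 \<le> h" "h < d" for s h
  proof (cases "h = 0")
    case False
    have "T (s + h) x - T s x = T s (T h x - x)"
      using C0_semigroup_add[OF T that(1,3)] by (simp add: blinfun.diff_right)
    also have "norm \<dots> \<le> norm (T s) * norm (T h x - x)" by (rule norm_blinfun)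
    also have "\<dots> \<le> M * norm (T h x - x)" using M that by (intro mult_right_mono) auto
    also have "\<dots> < M * (e / M)" using M(1) d(2)[of h] that False by (intro mult_strict_left_mono) auto
    finally show ?thesis using M(1) by simp
  qed (use e in simp)
  have "dist (T s x) (T t x) < e" if "s \<in> {0..}" "dist s t < min d 1" for s
    using step[of t "s - t"] step[of s "t - s"] that t
    by (cases "s \<le> t") (auto simp: dist_norm norm_minus_commute)
  then show "\<exists>d>0. \<forall>s\<in>{0..}. dist s t < d \<longrightarrow> dist (T s x) (T t x) < e"
    using d(1) by (intro exI[of _ "min d 1"]) auto
qed

section \<open>The sun dual\<close>

lemma blinfun_compose_diff_left:
  fixes f g :: "'b::real_normed_vector \<Rightarrow>\<^sub>L 'c::real_normed_vector"
  shows "(f - g) o\<^sub>L h = (f o\<^sub>L h) - (g o\<^sub>L h)"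
  by (rule blinfun_eqI) (simp add: blinfun.diff_left)

lemma blinfun_compose_diff_right:
  fixes f :: "'b::real_normed_vector \<Rightarrow>\<^sub>L 'c::real_normed_vector"
  shows "f o\<^sub>L (g - h) = (f o\<^sub>L g) - (f o\<^sub>L h)"
  by (rule blinfun_eqI) (simp add: blinfun.diff_left blinfun.diff_right)

lemma blinfun_compose_assoc: "(f o\<^sub>L g) o\<^sub>L h = f o\<^sub>L (g o\<^sub>L h)"
  by (rule blinfun_eqI) simp

lemma subspace_sun_dual: "subspace (sun_dual T)"
proof (rule subspaceI)
  have "(0 :: 'a \<Rightarrow>\<^sub>L real) o\<^sub>L T t = 0" for t by (rule blinfun_eqI) simp
  then show "0 \<in> sun_dual T" by (simp add: sun_dual_def)
  show "x + y \<in> sun_dual T" if "x \<in> sun_dual T" "y \<in> sun_dual T" for x y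
  proof -
    have lim: "((\<lambda>t. norm ((x o\<^sub>L T t) - x) + norm ((y o\<^sub>L T t) - y)) \<longlongrightarrow> 0 + 0) (at_right 0)"
      using that unfolding sun_dual_def by (intro tendsto_add) auto
    have le: "norm (((x + y) o\<^sub>L T t) - (x + y)) \<le> norm ((x o\<^sub>L T t) - x) + norm ((y o\<^sub>L T t) - y)" for t
    proof -
      have "((x + y) o\<^sub>L T t) - (x + y) = ((x o\<^sub>L T t) - x) + ((y o\<^sub>L T t) - y)"
        by (rule blinfun_eqI) (simp add: blinfun.add_left blinfun.diff_left)
      then show ?thesis using norm_triangle_ineq by metis
    qed
    have "((\<lambda>t. norm (((x + y) o\<^sub>L T t) - (x + y))) \<longlongrightarrow> 0) (at_right 0)"
    proof (rule Lim_null_comparison[OF always_eventually])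
      show "\<forall>t. norm (norm (((x + y) o\<^sub>L T t) - (x + y))) \<le> norm ((x o\<^sub>L T t) - x) + norm ((y o\<^sub>L T t) - y)"
        using le by simp
    qed (use lim in simp)
    then show ?thesis unfolding sun_dual_def by simp
  qed
  show "c *\<^sub>R x \<in> sun_dual T" if "x \<in> sun_dual T" for c x
  proof -
    have "((\<lambda>t. \<bar>c\<bar> * norm ((x o\<^sub>L T t) - x)) \<longlongrightarrow> \<bar>c\<bar> * 0) (at_right 0)"
      using that unfolding sun_dual_def by (intro tendsto_mult_left) auto
    moreover have "((c *\<^sub>R x) o\<^sub>L T t) - c *\<^sub>R x = c *\<^sub>R ((x o\<^sub>L T t) - x)" for t
      by (rule blinfun_eqI) (simp add: blinfun.diff_left blinfun.scaleR_left algebra_simps)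
    ultimately show ?thesis unfolding sun_dual_def by simp
  qed
qed

lemma sun_dual_invariant:
  assumes T: "C0_semigroup T" and y: "y \<in> sun_dual T" and t: "t \<ge> 0"
  shows "y o\<^sub>L T t \<in> sun_dual T"
proof -
  have lim: "((\<lambda>h. norm ((y o\<^sub>L T h) - y) * norm (T t)) \<longlongrightarrow> 0 * norm (T t)) (at_right 0)"
    using y unfolding sun_dual_def by (intro tendsto_mult_right) auto
  have le: "norm (((y o\<^sub>L T t) o\<^sub>L T h) - (y o\<^sub>L T t)) \<le> norm ((y o\<^sub>L T h) - y) * norm (T t)"
    if "h > 0" for h
  proof -
    have "T t o\<^sub>L T h = T h o\<^sub>L T t"
      using C0_semigroup_add[OF T, of t h] C0_semigroup_add[OF T, of h t] t that
      by (simp add: add.commute)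
    then have "((y o\<^sub>L T t) o\<^sub>L T h) - (y o\<^sub>L T t) = ((y o\<^sub>L T h) - y) o\<^sub>L T t"
      by (simp add: blinfun_compose_diff_left blinfun_compose_assoc)
    then show ?thesis by (simp add: norm_blinfun_compose)
  qed
  have "((\<lambda>h. norm (((y o\<^sub>L T t) o\<^sub>L T h) - (y o\<^sub>L T t))) \<longlongrightarrow> 0) (at_right 0)"
  proof (rule Lim_null_comparison)
    show "\<forall>\<^sub>F h in at_right 0. norm (norm (((y o\<^sub>L T t) o\<^sub>L T h) - (y o\<^sub>L T t)))
        \<le> norm ((y o\<^sub>L T h) - y) * norm (T t)"
      unfolding eventually_at_filter by (intro always_eventually) (use le in simp)
  qed (use lim in simp)
  then show ?thesis unfolding sun_dual_def by simp
qed

lemma sun_dual_orbit_continuous: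
  fixes T :: "real \<Rightarrow> 'a::banach \<Rightarrow>\<^sub>L 'a"
  assumes T: "C0_semigroup T" and y: "y \<in> sun_dual T"
  shows "continuous_on {0..} (\<lambda>t. y o\<^sub>L T t)"
  unfolding continuous_on_iff
proof (intro ballI allI impI)
  fix t e :: real assume t: "t \<in> {0..}" and e: "e > 0"
  obtain M where M: "M \<ge> 1" "\<And>s. 0 \<le> s \<Longrightarrow> s \<le> t + 1 \<Longrightarrow> norm (T s) \<le> M"
    using C0_semigroup_bounded[OF T] by blast
  have "\<forall>\<^sub>F h in at_right 0. dist (norm ((y o\<^sub>L T h) - y)) 0 < e / M"
    using y e M(1) unfolding sun_dual_def by (intro tendstoD) auto
  then obtain d where d: "d > 0" "\<And>h. 0 < h \<Longrightarrow> h < d \<Longrightarrow> norm ((y o\<^sub>L T h) - y) < e / M"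
    unfolding eventually_at_right_field by auto
  have step: "norm ((y o\<^sub>L T (s + h)) - (y o\<^sub>L T s)) < e"
    if "0 \<le> s" "s \<le> t + 1" "0 \<le> h" "h < d" for s h
  proof (cases "h = 0")
    case False
    have "(y o\<^sub>L T (s + h)) - (y o\<^sub>L T s) = ((y o\<^sub>L T h) - y) o\<^sub>L T s"
      using C0_semigroup_add[OF T that(3,1)]
      by (simp add: blinfun_compose_diff_left blinfun_compose_assoc add.commute)
    also have "norm \<dots> \<le> norm ((y o\<^sub>L T h) - y) * norm (T s)" by (rule norm_blinfun_compose)
    also have "\<dots> \<le> norm ((y o\<^sub>L T h) - y) * M" using M that by (intro mult_left_mono) auto
    also have "\<dots> < (e / M) * M" using M(1) d(2)[of h] that False by (intro mult_strict_right_mono) auto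
    finally show ?thesis using M(1) by simp
  qed (use e in simp)
  have "dist (y o\<^sub>L T s) (y o\<^sub>L T t) < e" if "s \<in> {0..}" "dist s t < min d 1" for s
    using step[of t "s - t"] step[of s "t - s"] that t
    by (cases "s \<le> t") (auto simp: dist_norm norm_minus_commute)
  then show "\<exists>d>0. \<forall>s\<in>{0..}. dist s t < d \<longrightarrow> dist (y o\<^sub>L T s) (y o\<^sub>L T t) < e"
    using d(1) by (intro exI[of _ "min d 1"]) auto
qed

text \<open>
  Averaging \<open>s \<mapsto> T s\<^sup>* f\<close> over \<open>{0..h}\<close> smooths \<open>f\<close>: shifting the average by \<open>t\<close>
  changes only the two end pieces of length \<open>t\<close>, so the average lies in the sun dual. As \<open>h\<close>
  decreases to \<open>0\<close> it still recovers the value of \<open>f\<close> at any given vector.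
\<close>

lemma sun_dual_approximation:
  fixes T :: "real \<Rightarrow> 'a::banach \<Rightarrow>\<^sub>L 'a" and f :: "'a \<Rightarrow>\<^sub>L real"
  assumes T: "C0_semigroup T" and M: "\<And>t. 0 \<le> t \<Longrightarrow> t \<le> 1 \<Longrightarrow> norm (T t) \<le> M"
    and e: "e > 0"
  obtains y where "y \<in> sun_dual T" "norm y \<le> M * norm f" "\<bar>y v - f v\<bar> \<le> e"
proof -
  have M0: "M \<ge> 0" using M[of 0] norm_ge_zero[of "T 0"] by linarith
  obtain M2 where M2: "M2 \<ge> 1" "\<And>t. 0 \<le> t \<Longrightarrow> t \<le> 2 \<Longrightarrow> norm (T t) \<le> M2"
    using C0_semigroup_bounded[OF T] by blast
  have cont: "continuous_on {0..} (\<lambda>s. f (T s x))" for x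
    by (intro continuous_intros C0_semigroup_orbit_continuous[OF T])
  then have cont': "continuous_on {a..b} (\<lambda>s. f (T s x))" if "a \<ge> 0" for a b x
    by (rule continuous_on_subset) (use that in auto)
  have int: "(\<lambda>s. f (T s x)) integrable_on {a..b}" if "a \<ge> 0" for a b x
    by (intro integrable_continuous_real cont' that)
  have bound: "\<bar>integral {a..b} (\<lambda>s. f (T s x))\<bar> \<le> norm f * K * norm x * (b - a)"
    if ab: "0 \<le> a" "a \<le> b" and K: "\<And>s. a \<le> s \<Longrightarrow> s \<le> b \<Longrightarrow> norm (T s) \<le> K" for a b K x
  proof -
    have "norm (f (T s x)) \<le> norm f * K * norm x" if "s \<in> {a..b}" for s
    proof -
      have "norm (f (T s x)) \<le> norm f * (norm (T s) * norm x)"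
        by (meson norm_blinfun mult_left_mono norm_ge_zero order_trans)
      also have "\<dots> \<le> norm f * (K * norm x)"
        using K that by (intro mult_left_mono mult_right_mono) auto
      finally show ?thesis by (simp add: mult.assoc)
    qed
    then have "norm (integral {a..b} (\<lambda>s. f (T s x))) \<le> norm f * K * norm x * (b - a)"
      using ab by (intro integral_bound cont') auto
    then show ?thesis by simp
  qed
  have "continuous (at 0 within {0..}) (\<lambda>s. f (T s v))"
    using cont[of v] by (simp add: continuous_on_eq_continuous_within)
  then obtain d where d: "d > 0" "\<And>s. 0 \<le> s \<Longrightarrow> s < d \<Longrightarrow> \<bar>f (T s v) - f v\<bar> < e"
    using e C0_semigroup_zero[OF T] unfolding continuous_within_eps_delta
    by (force simp: dist_norm)
  define h where "h = min (d / 2) 1"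
  have h: "h > 0" "h \<le> 1" "h < d" using d(1) by (auto simp: h_def)
  define m where "m x = integral {0..h} (\<lambda>s. f (T s x)) / h" for x
  have m_bound: "\<bar>m x\<bar> \<le> M * norm f * norm x" for x
    using bound[of 0 h M x] M h by (simp add: m_def field_simps)
  have bl: "bounded_linear m"
  proof (rule bounded_linear_intro)
    show "m (x + x') = m x + m x'" for x x'
      using int by (simp add: m_def blinfun.add_right integral_add add_divide_distrib)
    show "m (c *\<^sub>R x) = c *\<^sub>R m x" for c x
      by (simp add: m_def blinfun.scaleR_right)
    show "norm (m x) \<le> norm x * (M * norm f)" for x
      using m_bound[of x] by (simp add: mult_ac)
  qed
  define y where "y = Blinfun m"
  have y: "blinfun_apply y = m" unfolding y_def by (rule bounded_linear_Blinfun_apply[OF bl])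
  have y_norm: "norm y \<le> M * norm f"
    using m_bound M0 by (intro norm_blinfun_bound) (auto simp: y)
  \<comment> \<open>The bound on \<open>T\<close> up to time \<open>2\<close> covers the shifted end piece \<open>{h..h + t}\<close>.\<close>
  have shift: "norm ((y o\<^sub>L T t) - y) \<le> 2 * norm f * M2 * t / h" if t: "0 < t" "t \<le> 1" for t
  proof (rule norm_blinfun_bound)
    show "0 \<le> 2 * norm f * M2 * t / h" using M2(1) t h by simp
    fix x
    let ?F = "\<lambda>s. f (T s x)"
    have "integral {0..h} (\<lambda>s. f (T s (T t x))) = integral {0..h} (?F \<circ> (\<lambda>s. t + s))"
    proof (rule integral_cong)
      fix s assume "s \<in> {0..h}"
      then show "f (T s (T t x)) = (?F \<circ> (\<lambda>s. t + s)) s"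
        using C0_semigroup_add[OF T, of s t] t by (simp add: add.commute)
    qed
    also have "\<dots> = integral {0 + t..h + t} ?F"
      by (rule integral_unique[OF iffD2[OF has_integral_shift_Icc_real integrable_integral[OF int]]])
        (use t in simp)
    also have "\<dots> = integral {0..h} ?F + integral {h..h + t} ?F - integral {0..t} ?F"
      using Henstock_Kurzweil_Integration.integral_combine[of 0 t "h + t" ?F]
        Henstock_Kurzweil_Integration.integral_combine[of 0 h "h + t" ?F] int[of 0 _ "h + t"] t h
      by simp
    finally have eq: "((y o\<^sub>L T t) - y) x = (integral {h..h + t} ?F - integral {0..t} ?F) / h"
      by (simp add: blinfun.diff_left y m_def diff_divide_distrib add_divide_distrib)
    have "\<bar>integral {h..h + t} ?F\<bar> \<le> norm f * M2 * norm x * t"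
      using bound[of h "h + t" M2 x] M2(2) h t by simp
    moreover have "\<bar>integral {0..t} ?F\<bar> \<le> norm f * M2 * norm x * t"
      using bound[of 0 t M2 x] M2(2) h t by simp
    ultimately have "\<bar>integral {h..h + t} ?F - integral {0..t} ?F\<bar> \<le> 2 * norm f * M2 * t * norm x"
      by (simp add: algebra_simps) 
    then show "norm (((y o\<^sub>L T t) - y) x) \<le> 2 * norm f * M2 * t / h * norm x"
      unfolding eq using h by (simp add: divide_right_mono)
  qed
  have "y \<in> sun_dual T"
    unfolding sun_dual_def mem_Collect_eq
  proof (rule Lim_null_comparison)
    show "\<forall>\<^sub>F t in at_right 0. norm (norm ((y o\<^sub>L T t) - y)) \<le> 2 * norm f * M2 * t / h"
      unfolding eventually_at_right_field using shift by (intro exI[of _ 1]) auto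
    show "((\<lambda>t. 2 * norm f * M2 * t / h) \<longlongrightarrow> 0) (at_right 0)"
      using h by (auto intro!: tendsto_eq_intros)
  qed
  moreover have "\<bar>y v - f v\<bar> \<le> e"
  proof -
    have "norm (integral {0..h} (\<lambda>s. f (T s v) - f v)) \<le> e * (h - 0)"
      using h d(2) by (intro integral_bound continuous_intros cont') (auto intro: less_imp_le)
    moreover have "integral {0..h} (\<lambda>s. f (T s v) - f v) = h * (y v - f v)"
      using int[of 0 v h] h by (subst integral_diff) (auto simp: y m_def algebra_simps)
    ultimately show ?thesis using h by (simp add: abs_mult)
  qed
  ultimately show ?thesis using that y_norm by blast
qed

text \<open>
  Apply the approximation to a functional that norms \<open>v\<close>; its factor \<open>M\<close> survives in the bound.
  This is how vectors given by weak* integrals are estimated, and with \<open>c = 0\<close> it makes \<open>j\<close> injective.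
\<close>

lemma sun_dual_norming:
  fixes T :: "real \<Rightarrow> 'a::banach \<Rightarrow>\<^sub>L 'a"
  assumes T: "C0_semigroup T"
  obtains M where "M \<ge> 0"
    "\<And>v c. c \<ge> 0 \<Longrightarrow> (\<And>y. y \<in> sun_dual T \<Longrightarrow> \<bar>y v\<bar> \<le> c * norm y) \<Longrightarrow> norm v \<le> M * c"
proof -
  obtain M where M: "M \<ge> 1" "\<And>s. 0 \<le> s \<Longrightarrow> s \<le> 1 \<Longrightarrow> norm (T s) \<le> M"
    using C0_semigroup_bounded[OF T] by blast
  show ?thesis
  proof (rule that)
    show "M \<ge> 0" using M(1) by simp
    fix v :: 'a and c :: real assume c: "c \<ge> 0" and *: "\<And>y. y \<in> sun_dual T \<Longrightarrow> \<bar>y v\<bar> \<le> c * norm y"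
    obtain f :: "'a \<Rightarrow>\<^sub>L real" where f: "norm f \<le> 1" "f v = norm v"
      by (rule norming_functional_exists)
    show "norm v \<le> M * c"
    proof (rule field_le_epsilon)
      fix e :: real assume "e > 0"
      then obtain y where y: "y \<in> sun_dual T" "norm y \<le> M * norm f" "\<bar>y v - f v\<bar> \<le> e"
        using sun_dual_approximation[OF T M(2), of e f v] by blast
      have "norm y \<le> M" using y(2) f(1) M(1) mult_left_mono[of "norm f" 1 M] by linarith
      then have "c * norm y \<le> c * M" using c by (rule mult_left_mono)
      then show "norm v \<le> M * c + e" using *[OF y(1)] y(3) f(2) by (simp add: mult.commute)
    qed
  qed
qed

lemma sun_dual_separates:
  fixes T :: "real \<Rightarrow> 'a::banach \<Rightarrow>\<^sub>L 'a"
  assumes T: "C0_semigroup T" and eq: "\<And>y. y \<in> sun_dual T \<Longrightarrow> y v = y w"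
  shows "v = w"
proof -
  obtain M where M: "\<And>v c. c \<ge> 0 \<Longrightarrow> (\<And>y. y \<in> sun_dual T \<Longrightarrow> \<bar>y v\<bar> \<le> c * norm y) \<Longrightarrow> norm v \<le> M * c"
    using sun_dual_norming[OF T] by metis
  have "norm (v - w) \<le> M * 0" by (rule M) (auto simp: blinfun.diff_right eq)
  then show ?thesis by simp
qed

lemma inj_sun_embed:
  fixes T :: "real \<Rightarrow> 'a::banach \<Rightarrow>\<^sub>L 'a"
  assumes T: "C0_semigroup T"
  shows "inj (sun_embed T)"
proof (rule injI)
  fix v w assume "sun_embed T v = sun_embed T w"
  then have "lb_apply (sun_embed T v) y = lb_apply (sun_embed T w) y" for y by simp
  then show "v = w" by (intro sun_dual_separates[OF T]) (simp add: sun_embed.rep_eq, metis)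
qed

section \<open>Variation-of-constants integrals tested with the sun dual\<close>

text \<open>
  The value at \<open>y\<close> of the weak* integral of \<open>\<tau> \<mapsto> T\<^sup>\<odot>\<^sup>*(t - \<tau>) (g \<tau>)\<close> over \<open>{s..t}\<close>.
\<close>

definition duhamel :: "(real \<Rightarrow> 'a::real_normed_vector \<Rightarrow>\<^sub>L 'a) \<Rightarrow> (real \<Rightarrow> ('a \<Rightarrow>\<^sub>L real) lbfun) \<Rightarrow>
    real \<Rightarrow> real \<Rightarrow> ('a \<Rightarrow>\<^sub>L real) \<Rightarrow> real"
  where "duhamel T g s t y = integral {s..t} (\<lambda>\<tau>. lb_apply (g \<tau>) (y o\<^sub>L T (t - \<tau>)))"

lemma dual_on_diff:
  assumes "f \<in> dual_on V" "subspace V" "x \<in> V" "y \<in> V"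
  shows "lb_apply f (x - y) = lb_apply f x - lb_apply f y"
proof -
  have "(-1) *\<^sub>R y \<in> V" using assms by (intro subspace_scale)
  then have "lb_apply f (x + (-1) *\<^sub>R y) = lb_apply f x + lb_apply f ((-1) *\<^sub>R y)"
    using assms unfolding dual_on_def by blast
  moreover have "lb_apply f ((-1) *\<^sub>R y) = (-1) * lb_apply f y"
    using assms unfolding dual_on_def by blast
  ultimately show ?thesis by simp
qed

lemma continuous_on_lb_apply:
  assumes V: "subspace V" and g: "continuous_on S g" "g ` S \<subseteq> dual_on V"
    and y: "continuous_on S y" "y ` S \<subseteq> V"
  shows "continuous_on S (\<lambda>\<tau>. lb_apply (g \<tau>) (y \<tau>))"
  unfolding continuous_on_def
proof
  fix x assume x: "x \<in> S"
  have "((\<lambda>\<tau>. lb_apply (g \<tau>) (y \<tau>) - lb_apply (g x) (y x)) \<longlongrightarrow> 0) (at x within S)"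
  proof (rule Lim_null_comparison)
    have "norm (lb_apply (g \<tau>) (y \<tau>) - lb_apply (g x) (y x))
        \<le> norm (g \<tau> - g x) * norm (y \<tau>) + norm (g x) * norm (y \<tau> - y x)" if "\<tau> \<in> S" for \<tau>
    proof -
      have "g x \<in> dual_on V" "y \<tau> \<in> V" "y x \<in> V" using g y x that by auto
      then have "lb_apply (g \<tau>) (y \<tau>) - lb_apply (g x) (y x) =
          lb_apply (g \<tau> - g x) (y \<tau>) + lb_apply (g x) (y \<tau> - y x)"
        using V by (simp add: dual_on_diff minus_lbfun.rep_eq)
      then show ?thesis
        using lb_apply_le_norm[of "g \<tau> - g x" "y \<tau>"] lb_apply_le_norm[of "g x" "y \<tau> - y x"] by simp
    qed
    then show "\<forall>\<^sub>F \<tau> in at x within S. norm (lb_apply (g \<tau>) (y \<tau>) - lb_apply (g x) (y x))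
        \<le> norm (g \<tau> - g x) * norm (y \<tau>) + norm (g x) * norm (y \<tau> - y x)"
      unfolding eventually_at_filter by (intro always_eventually) blast
    have gx: "(g \<longlongrightarrow> g x) (at x within S)" and yx: "(y \<longlongrightarrow> y x) (at x within S)"
      using g y x unfolding continuous_on_def by auto
    have "((\<lambda>\<tau>. norm (g \<tau> - g x) * norm (y \<tau>) + norm (g x) * norm (y \<tau> - y x))
        \<longlongrightarrow> norm (g x - g x) * norm (y x) + norm (g x) * norm (y x - y x)) (at x within S)"
      by (intro tendsto_intros gx yx)
    then show "((\<lambda>\<tau>. norm (g \<tau> - g x) * norm (y \<tau>) + norm (g x) * norm (y \<tau> - y x))
        \<longlongrightarrow> 0) (at x within S)" by simp
  qed
  then show "((\<lambda>\<tau>. lb_apply (g \<tau>) (y \<tau>)) \<longlongrightarrow> lb_apply (g x) (y x)) (at x within S)"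
    by (rule LIM_zero_cancel)
qed

context
  fixes T :: "real \<Rightarrow> 'a::banach \<Rightarrow>\<^sub>L 'a"
  assumes T: "C0_semigroup T"
begin

lemma duhamel_integrand_continuous:
  assumes g: "continuous_on {s..t} g" "g ` {s..t} \<subseteq> sun_star_space T" and y: "y \<in> sun_dual T"
  shows "continuous_on {s..t} (\<lambda>\<tau>. lb_apply (g \<tau>) (y o\<^sub>L T (t - \<tau>)))"
proof (rule continuous_on_lb_apply[OF subspace_sun_dual g[unfolded sun_star_space_def]])
  show "continuous_on {s..t} (\<lambda>\<tau>. y o\<^sub>L T (t - \<tau>))"
    by (rule continuous_on_compose2[OF sun_dual_orbit_continuous[OF T y]])
      (auto intro!: continuous_intros)
  show "(\<lambda>\<tau>. y o\<^sub>L T (t - \<tau>)) ` {s..t} \<subseteq> sun_dual T"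
    using sun_dual_invariant[OF T y] by auto
qed

lemma duhamel_integrable:
  assumes "continuous_on {s..t} g" "g ` {s..t} \<subseteq> sun_star_space T" "y \<in> sun_dual T"
  shows "(\<lambda>\<tau>. lb_apply (g \<tau>) (y o\<^sub>L T (t - \<tau>))) integrable_on {s..t}"
  by (intro integrable_continuous_real duhamel_integrand_continuous assms)

lemma duhamel_bound:
  assumes g: "continuous_on {s..t} g" "g ` {s..t} \<subseteq> sun_star_space T" and y: "y \<in> sun_dual T"
    and st: "s \<le> t" and F: "\<And>\<tau>. s \<le> \<tau> \<Longrightarrow> \<tau> \<le> t \<Longrightarrow> norm (g \<tau>) \<le> F"
    and M: "\<And>\<sigma>. 0 \<le> \<sigma> \<Longrightarrow> \<sigma> \<le> t - s \<Longrightarrow> norm (T \<sigma>) \<le> M"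
  shows "\<bar>duhamel T g s t y\<bar> \<le> F * M * (t - s) * norm y"
proof -
  have F0: "0 \<le> F" using F[of s] st norm_ge_zero[of "g s"] by linarith
  have "norm (lb_apply (g \<tau>) (y o\<^sub>L T (t - \<tau>))) \<le> F * (norm y * M)" if "\<tau> \<in> {s..t}" for \<tau>
  proof -
    have "norm (y o\<^sub>L T (t - \<tau>)) \<le> norm y * norm (T (t - \<tau>))" by (rule norm_blinfun_compose)
    also have "\<dots> \<le> norm y * M" using M that by (intro mult_left_mono) auto
    finally have "norm (g \<tau>) * norm (y o\<^sub>L T (t - \<tau>)) \<le> F * (norm y * M)"
      using F that F0 by (intro mult_mono) auto
    then show ?thesis using lb_apply_le_norm[of "g \<tau>" "y o\<^sub>L T (t - \<tau>)"] by simp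
  qed
  then have "norm (duhamel T g s t y) \<le> F * (norm y * M) * (t - s)"
    unfolding duhamel_def by (intro integral_bound st duhamel_integrand_continuous g y)
  then show ?thesis by (simp add: mult_ac)
qed

lemma duhamel_add:
  assumes "continuous_on {s..t} f" "f ` {s..t} \<subseteq> sun_star_space T"
    and "continuous_on {s..t} g" "g ` {s..t} \<subseteq> sun_star_space T" and "y \<in> sun_dual T"
  shows "duhamel T (\<lambda>\<tau>. f \<tau> + g \<tau>) s t y = duhamel T f s t y + duhamel T g s t y"
  unfolding duhamel_def plus_lbfun.rep_eq by (intro integral_add duhamel_integrable assms)

lemma duhamel_split:
  assumes g: "continuous_on {s..t} g" "g ` {s..t} \<subseteq> sun_star_space T" and y: "y \<in> sun_dual T"
    and r: "s \<le> r" "r \<le> t"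
  shows "duhamel T g s t y = duhamel T g s r (y o\<^sub>L T (t - r)) + duhamel T g r t y"
proof -
  have "duhamel T g s r (y o\<^sub>L T (t - r)) = integral {s..r} (\<lambda>\<tau>. lb_apply (g \<tau>) (y o\<^sub>L T (t - \<tau>)))"
    unfolding duhamel_def
  proof (rule integral_cong)
    fix \<tau> assume "\<tau> \<in> {s..r}"
    then have "T (t - \<tau>) = T (t - r) o\<^sub>L T (r - \<tau>)"
      using C0_semigroup_add[OF T, of "t - r" "r - \<tau>"] r by simp
    then show "lb_apply (g \<tau>) ((y o\<^sub>L T (t - r)) o\<^sub>L T (r - \<tau>)) = lb_apply (g \<tau>) (y o\<^sub>L T (t - \<tau>))"
      by (simp add: blinfun_compose_assoc)
  qed
  then show ?thesis
    using Henstock_Kurzweil_Integration.integral_combine[OF r duhamel_integrable[OF g y]]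
    unfolding duhamel_def by simp
qed

end

lemma duhamel_shift: "duhamel T (\<lambda>\<tau>. g (c + \<tau>)) s t y = duhamel T g (c + s) (c + t) y"
proof -
  let ?F = "\<lambda>\<tau>. lb_apply (g \<tau>) (y o\<^sub>L T (c + t - \<tau>))"
  have "integral {s..t} (?F \<circ> (+) c) = integral {s + c..t + c} ?F"
    unfolding integral_def integrable_on_def has_integral_shift_Icc_real by (rule refl)
  then show ?thesis by (simp add: duhamel_def o_def add.commute)
qed

lemma duhamel_cong:
  "(\<And>\<tau>. s \<le> \<tau> \<Longrightarrow> \<tau> \<le> t \<Longrightarrow> f \<tau> = g \<tau>) \<Longrightarrow> duhamel T f s t y = duhamel T g s t y"
  unfolding duhamel_def by (intro integral_cong) simp

text \<open>
  The integrand contains \<open>S \<sigma> - T \<sigma>\<close> only for \<open>\<sigma>\<close> up to the length of the interval, which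
  contributes a second factor \<open>t - s\<close>.
\<close>

lemma duhamel_diff_semigroup:
  fixes S T :: "real \<Rightarrow> 'a::banach \<Rightarrow>\<^sub>L 'a"
  assumes S: "C0_semigroup S" and T: "C0_semigroup T" and V: "sun_dual S = sun_dual T"
    and g: "continuous_on {s..t} g" "g ` {s..t} \<subseteq> sun_star_space T" and y: "y \<in> sun_dual T"
    and st: "s \<le> t" and F: "\<And>\<tau>. s \<le> \<tau> \<Longrightarrow> \<tau> \<le> t \<Longrightarrow> norm (g \<tau>) \<le> F"
    and C: "C \<ge> 0" "\<And>\<sigma>. 0 \<le> \<sigma> \<Longrightarrow> \<sigma> \<le> t - s \<Longrightarrow> norm (S \<sigma> - T \<sigma>) \<le> C * \<sigma>"
  shows "\<bar>duhamel S g s t y - duhamel T g s t y\<bar> \<le> F * C * (t - s)\<^sup>2 * norm y"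
proof -
  have gS: "g ` {s..t} \<subseteq> sun_star_space S" and yS: "y \<in> sun_dual S"
    using g(2) y V by (simp_all add: sun_star_space_def)
  have F0: "0 \<le> F" using F[of s] st norm_ge_zero[of "g s"] by linarith
  let ?S = "\<lambda>\<tau>. lb_apply (g \<tau>) (y o\<^sub>L S (t - \<tau>))" and ?T = "\<lambda>\<tau>. lb_apply (g \<tau>) (y o\<^sub>L T (t - \<tau>))"
  have "norm (?S \<tau> - ?T \<tau>) \<le> F * (norm y * (C * (t - s)))" if \<tau>: "\<tau> \<in> {s..t}" for \<tau>
  proof -
    have "?S \<tau> - ?T \<tau> = lb_apply (g \<tau>) ((y o\<^sub>L S (t - \<tau>)) - (y o\<^sub>L T (t - \<tau>)))"
      using g(2) \<tau> sun_dual_invariant[OF S yS, of "t - \<tau>"] sun_dual_invariant[OF T y, of "t - \<tau>"] V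
      by (subst dual_on_diff[OF _ subspace_sun_dual[of T]]) (auto simp: sun_star_space_def)
    also have "\<dots> = lb_apply (g \<tau>) (y o\<^sub>L (S (t - \<tau>) - T (t - \<tau>)))"
      by (simp add: blinfun_compose_diff_right)
    finally have "norm (?S \<tau> - ?T \<tau>) \<le> norm (g \<tau>) * norm (y o\<^sub>L (S (t - \<tau>) - T (t - \<tau>)))"
      using lb_apply_le_norm by simp
    also have "\<dots> \<le> F * (norm y * (C * (t - s)))"
    proof (intro mult_mono F0 order_trans[OF norm_blinfun_compose])
      show "norm (S (t - \<tau>) - T (t - \<tau>)) \<le> C * (t - s)"
        using C(2)[of "t - \<tau>"] mult_left_mono[of "t - \<tau>" "t - s" C] C(1) \<tau> by simp
    qed (use F \<tau> in auto)
    finally show ?thesis .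
  qed
  then have "norm (integral {s..t} (\<lambda>\<tau>. ?S \<tau> - ?T \<tau>)) \<le> F * (norm y * (C * (t - s))) * (t - s)"
    by (intro integral_bound st continuous_intros duhamel_integrand_continuous[OF S]
        duhamel_integrand_continuous[OF T] g gS y yS)
  then show ?thesis
    unfolding duhamel_def
    using integral_diff[OF duhamel_integrable[OF S g(1) gS yS] duhamel_integrable[OF T g y]]
    by (simp add: power2_eq_square mult_ac)
qed

text \<open>
  Membership of a weak* integral in the range of the embedding is a statement about scalar
  integrals. For the converse direction, below, the integral has to be a bounded functional, since
  otherwise the abstraction to \<open>lbfun\<close> would lose its values.
\<close>

lemma weak_star_integral_eq_sun_embed:
  assumes V: "sun_dual T = sun_dual T\<^sub>0"
    and v: "\<And>y. y \<in> sun_dual T\<^sub>0 \<Longrightarrow> blinfun_apply y v = duhamel T g s t y"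
  shows "weak_star_integral s t (\<lambda>\<tau>. sun_star T (t - \<tau>) (g \<tau>)) = sun_embed T\<^sub>0 v"
proof -
  have "(\<lambda>y. integral {s..t} (\<lambda>\<tau>. lb_apply (sun_star T (t - \<tau>) (g \<tau>)) y)) = lb_apply (sun_embed T\<^sub>0 v)"
    using v V by (auto simp: sun_star.rep_eq sun_embed.rep_eq duhamel_def)
  then show ?thesis by (simp add: weak_star_integral_def lb_apply_inverse)
qed

lemma inv_sun_embed_weak_star_integral:
  fixes T T\<^sub>0 :: "real \<Rightarrow> 'a::banach \<Rightarrow>\<^sub>L 'a"
  assumes "C0_semigroup T\<^sub>0" "sun_dual T = sun_dual T\<^sub>0"
    and "\<And>y. y \<in> sun_dual T\<^sub>0 \<Longrightarrow> y v = duhamel T g s t y"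
  shows "inv (sun_embed T\<^sub>0) (weak_star_integral s t (\<lambda>\<tau>. sun_star T (t - \<tau>) (g \<tau>))) = v"
  using weak_star_integral_eq_sun_embed[OF assms(2,3)] inj_sun_embed[OF assms(1)] by simp

lemma weak_star_integral_eq_sun_embedD:
  fixes T :: "real \<Rightarrow> 'a::banach \<Rightarrow>\<^sub>L 'a"
  assumes T: "C0_semigroup T" and g: "continuous_on {s..t} g" "g ` {s..t} \<subseteq> sun_star_space T"
    and st: "s \<le> t" and eq: "weak_star_integral s t (\<lambda>\<tau>. sun_star T (t - \<tau>) (g \<tau>)) = sun_embed T v"
    and y: "y \<in> sun_dual T"
  shows "y v = duhamel T g s t y"
proof -
  let ?I = "\<lambda>y. integral {s..t} (\<lambda>\<tau>. lb_apply (sun_star T (t - \<tau>) (g \<tau>)) y)"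
  obtain M where M: "M \<ge> 1" "\<And>\<sigma>. 0 \<le> \<sigma> \<Longrightarrow> \<sigma> \<le> t - s \<Longrightarrow> norm (T \<sigma>) \<le> M"
    using C0_semigroup_bounded[OF T] by blast
  have "bounded (g ` {s..t})" by (intro compact_imp_bounded compact_continuous_image g) simp
  then obtain F where F: "\<And>\<tau>. s \<le> \<tau> \<Longrightarrow> \<tau> \<le> t \<Longrightarrow> norm (g \<tau>) \<le> F"
    unfolding bounded_iff by (metis atLeastAtMost_iff imageI)
  have F0: "0 \<le> F" using F[of s] st norm_ge_zero[of "g s"] by linarith
  have I: "?I y = (if y \<in> sun_dual T then duhamel T g s t y else 0)" for y
    by (simp add: sun_star.rep_eq duhamel_def)
  have "\<bar>?I y\<bar> \<le> (F * M * (t - s)) * norm y" for y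
    using duhamel_bound[OF T g _ st F M(2), of y] F0 M(1) st unfolding I by simp
  then have "lb_apply (weak_star_integral s t (\<lambda>\<tau>. sun_star T (t - \<tau>) (g \<tau>))) = ?I"
    unfolding weak_star_integral_def by (intro Lbfun_inverse) blast
  then have "lb_apply (sun_embed T v) y = ?I y" unfolding eq by simp
  then show ?thesis using y I by (simp add: sun_embed.rep_eq)
qed

section \<open>Admissible ranges under perturbation\<close>

text \<open>
  The interval in the definition of an admissible range can be translated, so only its length
  matters. Continuous functions on shorter intervals are extended to it by constants.
\<close>

lemma admissible_range_short_intervals:
  fixes T :: "real \<Rightarrow> 'a::banach \<Rightarrow>\<^sub>L 'a"
  assumes T: "C0_semigroup T" and X: "admissible_range T \<X>"
  obtains d where "d > 0"
    "\<And>g s h. 0 \<le> h \<Longrightarrow> h \<le> d \<Longrightarrow> continuous_on {s..s + h} g \<Longrightarrow> g ` {s..s + h} \<subseteq> \<X> \<Longrightarrow>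
       \<exists>v. \<forall>y\<in>sun_dual T. blinfun_apply y v = duhamel T g s (s + h) y"
proof -
  obtain J a b where J: "is_interval J" "a \<in> J" "b \<in> J" "a < b" and XT: "\<X> \<subseteq> sun_star_space T"
    and adm: "\<And>f s t. continuous_on J f \<Longrightarrow> f ` J \<subseteq> \<X> \<Longrightarrow> s \<in> J \<Longrightarrow> t \<in> J \<Longrightarrow> s \<le> t \<Longrightarrow>
      weak_star_integral s t (\<lambda>\<tau>. sun_star T (t - \<tau>) (f \<tau>)) \<in> range (sun_embed T)"
    using X unfolding admissible_range_def by blast
  show ?thesis
  proof (rule that)
    show "b - a > 0" using J by simp
    fix g s h assume h: "0 \<le> h" "h \<le> b - a" and g: "continuous_on {s..s + h} g" "g ` {s..s + h} \<subseteq> \<X>"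
    define f where "f \<tau> = g (max s (min (s + h) ((s - a) + \<tau>)))" for \<tau>
    have f: "continuous_on A f" for A
      unfolding f_def using h by (intro continuous_on_compose2[OF g(1)] continuous_intros) auto
    have fX: "f ` A \<subseteq> \<X>" for A
      unfolding f_def using h g(2) by auto
    have "a + h \<in> J" by (rule mem_is_interval_1_I[OF J(1-3)]) (use h in auto)
    then obtain v where v: "weak_star_integral a (a + h) (\<lambda>\<tau>. sun_star T (a + h - \<tau>) (f \<tau>)) = sun_embed T v"
      using adm[OF f fX J(2), of "a + h"] h by auto
    have "y v = duhamel T g s (s + h) y" if y: "y \<in> sun_dual T" for y
    proof -
      have "y v = duhamel T f a (a + h) y"
        using h XT fX by (intro weak_star_integral_eq_sun_embedD[OF T f _ _ v y]) auto
      also have "\<dots> = duhamel T (\<lambda>\<tau>. g ((s - a) + \<tau>)) a (a + h) y"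
        by (rule duhamel_cong) (simp add: f_def)
      also have "\<dots> = duhamel T g s (s + h) y" by (simp add: duhamel_shift)
      finally show ?thesis .
    qed
    then show "\<exists>v. \<forall>y\<in>sun_dual T. blinfun_apply y v = duhamel T g s (s + h) y" by blast
  qed
qed

text \<open>
  Since the sun dual is norming, approximate representing vectors form a Cauchy sequence; this is
  the closedness of the range of \<open>j\<close>.
\<close>

lemma sun_dual_representation_limit:
  fixes T :: "real \<Rightarrow> 'a::banach \<Rightarrow>\<^sub>L 'a"
  assumes T: "C0_semigroup T"
    and approx: "\<And>e. e > 0 \<Longrightarrow> \<exists>w. \<forall>y\<in>sun_dual T. \<bar>blinfun_apply y w - D y\<bar> \<le> e * norm y"
  shows "\<exists>w. \<forall>y\<in>sun_dual T. blinfun_apply y w = D y"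
proof -
  obtain M where M: "M \<ge> 0"
    "\<And>v c. c \<ge> 0 \<Longrightarrow> (\<And>y. y \<in> sun_dual T \<Longrightarrow> \<bar>y v\<bar> \<le> c * norm y) \<Longrightarrow> norm v \<le> M * c"
    using sun_dual_norming[OF T] by metis
  have "\<forall>n. \<exists>w. \<forall>y\<in>sun_dual T. \<bar>blinfun_apply y w - D y\<bar> \<le> inverse (real (Suc n)) * norm y"
    using approx by simp
  then obtain w where w: "\<And>n y. y \<in> sun_dual T \<Longrightarrow> \<bar>y (w n) - D y\<bar> \<le> inverse (real (Suc n)) * norm y"
    by metis
  have dist: "norm (w m - w n) \<le> M * (inverse (real (Suc m)) + inverse (real (Suc n)))" for m n
  proof (rule M(2))
    fix y assume y: "y \<in> sun_dual T"
    show "\<bar>y (w m - w n)\<bar> \<le> (inverse (real (Suc m)) + inverse (real (Suc n))) * norm y"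
      using w[OF y, of m] w[OF y, of n] by (simp only: blinfun.diff_right distrib_right)
  qed simp
  have "Cauchy w"
  proof (rule metric_CauchyI)
    fix e :: real assume e: "e > 0"
    then obtain N where N: "inverse (real (Suc N)) < e / (2 * (M + 1))"
      using reals_Archimedean[of "e / (2 * (M + 1))"] M(1) by auto
    have "dist (w m) (w n) < e" if "m \<ge> N" "n \<ge> N" for m n
    proof -
      have "inverse (real (Suc m)) \<le> inverse (real (Suc N))" "inverse (real (Suc n)) \<le> inverse (real (Suc N))"
        using that by (auto intro!: le_imp_inverse_le)
      then have "norm (w m - w n) \<le> M * (inverse (real (Suc N)) + inverse (real (Suc N)))"
        using M(1) by (intro order_trans[OF dist] mult_left_mono add_mono)
      also have "\<dots> \<le> (M + 1) * (2 * inverse (real (Suc N)))" by (simp add: algebra_simps)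
      also have "\<dots> < e" using N M(1) by (simp add: field_simps)
      finally show ?thesis by (simp add: dist_norm)
    qed
    then show "\<exists>N. \<forall>m\<ge>N. \<forall>n\<ge>N. dist (w m) (w n) < e" by blast
  qed
  then obtain z where z: "w \<longlonglongrightarrow> z" using Cauchy_convergent convergent_def by blast
  have "y z = D y" if y: "y \<in> sun_dual T" for y
  proof -
    have "(\<lambda>n. y (w n) - D y) \<longlonglongrightarrow> 0"
    proof (rule Lim_null_comparison)
      show "\<forall>\<^sub>F n in sequentially. norm (y (w n) - D y) \<le> inverse (real (Suc n)) * norm y"
        using w[OF y] by simp
      show "(\<lambda>n. inverse (real (Suc n)) * norm y) \<longlonglongrightarrow> 0"
        using tendsto_mult_right[OF LIMSEQ_inverse_real_of_nat, of "norm y"] by simp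
    qed
    then have "(\<lambda>n. y (w n)) \<longlonglongrightarrow> D y" by (rule LIM_zero_cancel)
    moreover have "(\<lambda>n. y (w n)) \<longlonglongrightarrow> y z" by (intro tendsto_intros z)
    ultimately show ?thesis using LIMSEQ_unique by blast
  qed
  then show ?thesis by blast
qed

text \<open>
  Cut \<open>{0..a}\<close> into pieces of length \<open>h\<close>. On each piece admissibility for \<open>T\<close> provides a
  vector representing the integral with \<open>T\<close>, and replacing \<open>T\<close> by \<open>S\<close> there costs only
  \<open>O(h\<^sup>2)\<close>, because \<open>S \<sigma> - T \<sigma>\<close> is \<open>O(\<sigma>)\<close>. Transporting the pieces to \<open>a\<close>
  with \<open>S\<close> and adding them up leaves a total error \<open>O(h)\<close>, which vanishes in the limit. With
  \<open>S = T\<close> this shows that admissibility on one interval implies it on all.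
\<close>

lemma admissible_range_nearby_semigroup:
  fixes S T :: "real \<Rightarrow> 'a::banach \<Rightarrow>\<^sub>L 'a"
  assumes S: "C0_semigroup S" and T: "C0_semigroup T" and V: "sun_dual S = sun_dual T"
    and X: "admissible_range T \<X>"
    and C: "C \<ge> 0" "b > 0" "\<And>\<sigma>. 0 \<le> \<sigma> \<Longrightarrow> \<sigma> \<le> b \<Longrightarrow> norm (S \<sigma> - T \<sigma>) \<le> C * \<sigma>"
    and a: "a \<ge> 0" and g: "continuous_on {0..a} g" "g ` {0..a} \<subseteq> \<X>"
  shows "\<exists>w. \<forall>y\<in>sun_dual T. blinfun_apply y w = duhamel S g 0 a y"
proof (rule sun_dual_representation_limit[OF T])
  fix e :: real assume e: "e > 0"
  obtain d where d: "d > 0"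
    "\<And>g s h. 0 \<le> h \<Longrightarrow> h \<le> d \<Longrightarrow> continuous_on {s..s + h} g \<Longrightarrow> g ` {s..s + h} \<subseteq> \<X> \<Longrightarrow>
       \<exists>v. \<forall>y\<in>sun_dual T. blinfun_apply y v = duhamel T g s (s + h) y"
    using admissible_range_short_intervals[OF T X] by metis
  have XT: "\<X> \<subseteq> sun_star_space T" and XS: "\<X> \<subseteq> sun_star_space S"
    using X V by (auto simp: admissible_range_def sun_star_space_def)
  obtain M where M: "M \<ge> 1" "\<And>t. 0 \<le> t \<Longrightarrow> t \<le> a \<Longrightarrow> norm (S t) \<le> M"
    using C0_semigroup_bounded[OF S] by blast
  have "bounded (g ` {0..a})" by (intro compact_imp_bounded compact_continuous_image g) simp
  then obtain F where F: "\<And>\<tau>. 0 \<le> \<tau> \<Longrightarrow> \<tau> \<le> a \<Longrightarrow> norm (g \<tau>) \<le> F"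
    unfolding bounded_iff by (metis atLeastAtMost_iff imageI)
  have F0: "0 \<le> F" using F[of 0] a norm_ge_zero[of "g 0"] by linarith
  define K where "K = F * C * M"
  have K: "K \<ge> 0" using F0 C(1) M(1) by (simp add: K_def)
  \<comment> \<open>Pieces of length \<open>a / N\<close> admit representing vectors and the estimate of \<open>S - T\<close>, and the total
    error \<open>K * a\<^sup>2 / N\<close> is at most \<open>e\<close>.\<close>
  obtain N where N: "1 + a / min d b + K * a\<^sup>2 / e \<le> real N" using real_arch_simple by blast
  have N1: "real N \<ge> 1" "a / min d b \<le> real N" "K * a\<^sup>2 / e \<le> real N"
  proof -
    have "0 \<le> a / min d b" "0 \<le> K * a\<^sup>2 / e" using a d(1) C(2) K e by simp_all
    then show "real N \<ge> 1" "a / min d b \<le> real N" "K * a\<^sup>2 / e \<le> real N" using N by linarith+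
  qed
  define h where "h = a / real N"
  have h: "h \<ge> 0" "real N * h = a" using a N1(1) by (auto simp: h_def)
  have "min d b > 0" using d(1) C(2) by simp
  with N1(2) have "a \<le> real N * min d b" by (simp only: pos_divide_le_eq)
  then have "a \<le> min d b * real N" by (simp only: mult.commute)
  moreover have "0 < real N" using N1(1) by simp
  ultimately have "h \<le> min d b" unfolding h_def by (simp only: pos_divide_le_eq)
  then have hd: "h \<le> d" "h \<le> b" by simp_all
  have Kh: "real N * (K * h\<^sup>2) \<le> e"
  proof -
    have "real N * (K * h\<^sup>2) = K * a\<^sup>2 / real N" using N1(1) by (simp add: h_def power2_eq_square)
    also have "\<dots> \<le> e" using N1(1,3) e by (simp add: field_simps)
    finally show ?thesis .
  qed
  \<comment> \<open>The additional transport by \<open>S r\<close> keeps the constant \<open>M\<close> from being multiplied in each step.\<close>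
  have step: "\<exists>w. \<forall>y\<in>sun_dual T. \<forall>r\<ge>0. real n * h + r \<le> a \<longrightarrow>
      \<bar>blinfun_apply y (S r w) - duhamel S g 0 (real n * h) (y o\<^sub>L S r)\<bar> \<le> real n * (K * h\<^sup>2) * norm y"
    if "n \<le> N" for n
    using that
  proof (induction n)
    case 0
    have "duhamel S g 0 0 y = 0" for y by (simp add: duhamel_def)
    then show ?case by (intro exI[of _ 0]) simp
  next
    case (Suc n)
    then obtain w where w: "\<And>y r. y \<in> sun_dual T \<Longrightarrow> r \<ge> 0 \<Longrightarrow> real n * h + r \<le> a \<Longrightarrow>
      \<bar>y (S r w) - duhamel S g 0 (real n * h) (y o\<^sub>L S r)\<bar> \<le> real n * (K * h\<^sup>2) * norm y" by auto
    let ?s = "real n * h"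
    have s: "0 \<le> ?s" "?s + h \<le> a" "real (Suc n) * h = ?s + h"
      using h mult_right_mono[of "real (Suc n)" "real N" h] Suc.prems by (auto simp: algebra_simps)
    have g_sub: "continuous_on A g" "g ` A \<subseteq> \<X>" if "A \<subseteq> {0..a}" for A
      using g that by (blast intro: continuous_on_subset)+
    obtain k where k: "\<And>y. y \<in> sun_dual T \<Longrightarrow> y k = duhamel T g ?s (?s + h) y"
      using d(2)[OF h(1) hd(1) g_sub(1,2), of ?s] s by auto
    have "\<bar>y (S r (S h w + k)) - duhamel S g 0 (?s + h) (y o\<^sub>L S r)\<bar> \<le> real (Suc n) * (K * h\<^sup>2) * norm y"
      if y: "y \<in> sun_dual T" and r: "r \<ge> 0" "?s + h + r \<le> a" for y r
    proof -
      have yr: "y o\<^sub>L S r \<in> sun_dual T" using sun_dual_invariant[OF S _ r(1)] y V by auto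
      have Srh: "S (r + h) = S r o\<^sub>L S h" using C0_semigroup_add[OF S r(1) h(1)] .
      have yrh: "(y o\<^sub>L S r) o\<^sub>L S h = y o\<^sub>L S (r + h)" by (simp add: Srh blinfun_compose_assoc)
      have "duhamel S g 0 (?s + h) (y o\<^sub>L S r) =
          duhamel S g 0 ?s (y o\<^sub>L S (r + h)) + duhamel S g ?s (?s + h) (y o\<^sub>L S r)"
        using duhamel_split[OF S g_sub(1) _ _ s(1), of "?s + h" "y o\<^sub>L S r"] g_sub(2)[of "{0..?s + h}"]
          s h(1) XS yr V yrh by auto
      moreover have "y (S r (S h w + k)) = y (S (r + h) w) + (y o\<^sub>L S r) k"
        by (simp add: Srh blinfun.add_right)
      moreover have "\<bar>y (S (r + h) w) - duhamel S g 0 ?s (y o\<^sub>L S (r + h))\<bar> \<le> real n * (K * h\<^sup>2) * norm y"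
        using w[OF y, of "r + h"] r h(1) by (simp add: algebra_simps)
      moreover have "\<bar>(y o\<^sub>L S r) k - duhamel S g ?s (?s + h) (y o\<^sub>L S r)\<bar> \<le> K * h\<^sup>2 * norm y"
      proof -
        have "\<bar>duhamel S g ?s (?s + h) (y o\<^sub>L S r) - duhamel T g ?s (?s + h) (y o\<^sub>L S r)\<bar>
            \<le> F * C * (?s + h - ?s)\<^sup>2 * norm (y o\<^sub>L S r)"
        proof (rule duhamel_diff_semigroup[OF S T V g_sub(1) _ yr _ _ C(1)])
          show "g ` {?s..?s + h} \<subseteq> sun_star_space T" using g_sub(2)[of "{?s..?s + h}"] s XT by auto
          show "norm (S \<sigma> - T \<sigma>) \<le> C * \<sigma>" if "0 \<le> \<sigma>" "\<sigma> \<le> ?s + h - ?s" for \<sigma>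
            using C(3) that hd(2) by simp
          show "norm (g \<tau>) \<le> F" if "?s \<le> \<tau>" "\<tau> \<le> ?s + h" for \<tau>
            by (rule F) (use that s in linarith)+
        qed (use s h(1) in auto)
        also have "\<dots> \<le> F * C * h\<^sup>2 * (norm y * M)"
        proof -
          have "norm (y o\<^sub>L S r) \<le> norm y * M"
            using M(2)[of r] r s h
            by (intro order_trans[OF norm_blinfun_compose] mult_left_mono) auto
          then show ?thesis using F0 C(1) by (simp add: mult_left_mono)
        qed
        also have "\<dots> = K * h\<^sup>2 * norm y" by (simp add: K_def)
        finally show ?thesis using k[OF yr] by (simp add: abs_minus_commute)
      qed
      moreover have "real (Suc n) * (K * h\<^sup>2) * norm y = real n * (K * h\<^sup>2) * norm y + K * h\<^sup>2 * norm y"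
        by (simp add: algebra_simps)
      ultimately show ?thesis by linarith
    qed
    then show ?case unfolding s(3) by (intro exI[of _ "S h w + k"]) blast
  qed
  obtain w where w: "\<And>y r. y \<in> sun_dual T \<Longrightarrow> r \<ge> 0 \<Longrightarrow> real N * h + r \<le> a \<Longrightarrow>
      \<bar>y (S r w) - duhamel S g 0 (real N * h) (y o\<^sub>L S r)\<bar> \<le> real N * (K * h\<^sup>2) * norm y"
    using step[of N] by auto
  have "\<bar>y w - duhamel S g 0 a y\<bar> \<le> e * norm y" if y: "y \<in> sun_dual T" for y
  proof -
    have "\<bar>y w - duhamel S g 0 a y\<bar> \<le> real N * (K * h\<^sup>2) * norm y"
    proof -
      have "y o\<^sub>L S 0 = y" by (rule blinfun_eqI) (simp add: C0_semigroup_zero[OF S])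
      then show ?thesis using w[OF y, of 0] h(2) C0_semigroup_zero[OF S] by simp
    qed
    also have "\<dots> \<le> e * norm y" using Kh by (intro mult_right_mono) auto
    finally show ?thesis .
  qed
  then show "\<exists>w. \<forall>y\<in>sun_dual T. \<bar>blinfun_apply y w - duhamel S g 0 a y\<bar> \<le> e * norm y" by blast
qed

lemma sun_dual_eq_of_close:
  fixes S T :: "real \<Rightarrow> 'a::banach \<Rightarrow>\<^sub>L 'a"
  assumes "\<And>\<sigma>. 0 \<le> \<sigma> \<Longrightarrow> \<sigma> \<le> 1 \<Longrightarrow> norm (S \<sigma> - T \<sigma>) \<le> C * \<sigma>"
  shows "sun_dual S = sun_dual T"
proof -
  have sub: "sun_dual S \<subseteq> sun_dual T"
    if close: "\<And>\<sigma>. 0 \<le> \<sigma> \<Longrightarrow> \<sigma> \<le> 1 \<Longrightarrow> norm (T \<sigma> - S \<sigma>) \<le> C * \<sigma>" for S T :: "real \<Rightarrow> 'a \<Rightarrow>\<^sub>L 'a"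
  proof
    fix y assume y: "y \<in> sun_dual S"
    have "((\<lambda>t. norm ((y o\<^sub>L T t) - y)) \<longlongrightarrow> 0) (at_right 0)"
    proof (rule Lim_null_comparison)
      have "norm ((y o\<^sub>L T t) - y) \<le> norm y * (C * t) + norm ((y o\<^sub>L S t) - y)" if "0 < t" "t < 1" for t
      proof -
        have "(y o\<^sub>L T t) - y = (y o\<^sub>L (T t - S t)) + ((y o\<^sub>L S t) - y)"
          by (simp add: blinfun_compose_diff_right)
        then have "norm ((y o\<^sub>L T t) - y) \<le> norm (y o\<^sub>L (T t - S t)) + norm ((y o\<^sub>L S t) - y)"
          by (metis norm_triangle_ineq)
        moreover have "norm (y o\<^sub>L (T t - S t)) \<le> norm y * (C * t)"
          using close[of t] that by (intro order_trans[OF norm_blinfun_compose] mult_left_mono) auto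
        ultimately show ?thesis by simp
      qed
      then show "\<forall>\<^sub>F t in at_right 0. norm (norm ((y o\<^sub>L T t) - y)) \<le> norm y * (C * t) + norm ((y o\<^sub>L S t) - y)"
        unfolding eventually_at_right_field by (intro exI[of _ 1]) auto
      have "((\<lambda>t. norm y * (C * t) + norm ((y o\<^sub>L S t) - y)) \<longlongrightarrow> norm y * (C * 0) + 0) (at_right 0)"
        using y unfolding sun_dual_def by (intro tendsto_intros) auto
      then show "((\<lambda>t. norm y * (C * t) + norm ((y o\<^sub>L S t) - y)) \<longlongrightarrow> 0) (at_right 0)" by simp
    qed
    then show "y \<in> sun_dual T" by (simp add: sun_dual_def)
  qed
  show ?thesis
    using sub[of S T] sub[of T S] assms by (auto simp: norm_minus_commute)
qed

text \<open>
  The integral in the definition of the perturbed semigroup lies in the range of \<open>j\<close>, so that the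
  inverse of \<open>j\<close> can be cancelled.
\<close>

lemma perturbed_semigroup_variation_of_constants:
  fixes T\<^sub>0 T :: "real \<Rightarrow> 'a::banach \<Rightarrow>\<^sub>L 'a"
  assumes T0: "C0_semigroup T\<^sub>0" and X: "admissible_range T\<^sub>0 \<X>"
    and L: "bounded_linear L" "range L \<subseteq> \<X>" and P: "perturbed_semigroup T\<^sub>0 L T"
    and t: "t \<ge> 0" and y: "y \<in> sun_dual T\<^sub>0"
  shows "y (T t x) = y (T\<^sub>0 t x) + duhamel T\<^sub>0 (\<lambda>\<tau>. L (T \<tau> x)) 0 t y"
proof -
  have T: "C0_semigroup T" using P by (simp add: perturbed_semigroup_def)
  have c: "continuous_on {0..t} (\<lambda>\<tau>. L (T \<tau> x))"
    by (rule bounded_linear.continuous_on[OF L(1)])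
      (auto intro: continuous_on_subset[OF C0_semigroup_orbit_continuous[OF T]])
  have "(\<lambda>\<tau>. L (T \<tau> x)) ` {0..t} \<subseteq> \<X>" using L(2) by blast
  \<comment> \<open>The semigroup \<open>T\<^sub>0\<close> is near to itself, with constant \<open>0\<close>.\<close>
  then obtain v where v: "\<And>y. y \<in> sun_dual T\<^sub>0 \<Longrightarrow> y v = duhamel T\<^sub>0 (\<lambda>\<tau>. L (T \<tau> x)) 0 t y"
    using admissible_range_nearby_semigroup[OF T0 T0 refl X _ _ _ t c, of 0 1] by auto
  have "T t x = T\<^sub>0 t x + v"
    using P t inv_sun_embed_weak_star_integral[OF T0 refl v]
    unfolding perturbed_semigroup_def by simp
  then show ?thesis using v[OF y] by (simp add: blinfun.add_right)
qed

text \<open>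
  The difference of the semigroups is represented by an integral over an interval of length \<open>\<sigma>\<close> with
  a bounded integrand, and the sun dual is norming.
\<close>

lemma perturbed_semigroup_close:
  fixes T\<^sub>0 T :: "real \<Rightarrow> 'a::banach \<Rightarrow>\<^sub>L 'a"
  assumes T0: "C0_semigroup T\<^sub>0" and X: "admissible_range T\<^sub>0 \<X>"
    and L: "bounded_linear L" "range L \<subseteq> \<X>" and P: "perturbed_semigroup T\<^sub>0 L T"
  obtains C where "C \<ge> 0" "\<And>\<sigma>. 0 \<le> \<sigma> \<Longrightarrow> \<sigma> \<le> a \<Longrightarrow> norm (T \<sigma> - T\<^sub>0 \<sigma>) \<le> C * \<sigma>"
proof -
  have T: "C0_semigroup T" using P by (simp add: perturbed_semigroup_def)
  have XT: "\<X> \<subseteq> sun_star_space T\<^sub>0" using X by (simp add: admissible_range_def)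
  obtain M where M: "M \<ge> 1" "\<And>t. 0 \<le> t \<Longrightarrow> t \<le> a \<Longrightarrow> norm (T t) \<le> M"
    using C0_semigroup_bounded[OF T] by blast
  obtain M\<^sub>0 where M0: "M\<^sub>0 \<ge> 1" "\<And>t. 0 \<le> t \<Longrightarrow> t \<le> a \<Longrightarrow> norm (T\<^sub>0 t) \<le> M\<^sub>0"
    using C0_semigroup_bounded[OF T0] by blast
  obtain B where B: "B \<ge> 0" "\<And>x. norm (L x) \<le> norm x * B"
    using bounded_linear.nonneg_bounded[OF L(1)] by blast
  obtain c where c: "c \<ge> 0"
    "\<And>v e. e \<ge> 0 \<Longrightarrow> (\<And>y. y \<in> sun_dual T\<^sub>0 \<Longrightarrow> \<bar>y v\<bar> \<le> e * norm y) \<Longrightarrow> norm v \<le> c * e"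
    using sun_dual_norming[OF T0] by metis
  show ?thesis
  proof (rule that)
    show "c * (M * B * M\<^sub>0) \<ge> 0" using c(1) M(1) B(1) M0(1) by simp
    fix \<sigma> assume \<sigma>: "0 \<le> \<sigma>" "\<sigma> \<le> a"
    show "norm (T \<sigma> - T\<^sub>0 \<sigma>) \<le> c * (M * B * M\<^sub>0) * \<sigma>"
    proof (rule norm_blinfun_bound)
      show "0 \<le> c * (M * B * M\<^sub>0) * \<sigma>" using c(1) M(1) B(1) M0(1) \<sigma> by simp
      fix x
      have cont: "continuous_on {0..\<sigma>} (\<lambda>\<tau>. L (T \<tau> x))"
        by (rule bounded_linear.continuous_on[OF L(1)])
          (auto intro: continuous_on_subset[OF C0_semigroup_orbit_continuous[OF T]])
      have F: "norm (L (T \<tau> x)) \<le> M * norm x * B" if "0 \<le> \<tau>" "\<tau> \<le> \<sigma>" for \<tau>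
      proof -
        have "norm (T \<tau> x) \<le> norm (T \<tau>) * norm x" by (rule norm_blinfun)
        also have "\<dots> \<le> M * norm x" using M(2)[of \<tau>] that \<sigma> by (intro mult_right_mono) auto
        finally have "norm (T \<tau> x) * B \<le> M * norm x * B" using B(1) by (rule mult_right_mono)
        then show ?thesis using B(2)[of "T \<tau> x"] by simp
      qed
      have "norm ((T \<sigma> - T\<^sub>0 \<sigma>) x) \<le> c * (M * norm x * B * M\<^sub>0 * (\<sigma> - 0))"
      proof (rule c(2))
        show "0 \<le> M * norm x * B * M\<^sub>0 * (\<sigma> - 0)" using M(1) B(1) M0(1) \<sigma> by simp
        fix y assume y: "y \<in> sun_dual T\<^sub>0"
        have "y ((T \<sigma> - T\<^sub>0 \<sigma>) x) = duhamel T\<^sub>0 (\<lambda>\<tau>. L (T \<tau> x)) 0 \<sigma> y"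
          using perturbed_semigroup_variation_of_constants[OF T0 X L P \<sigma>(1) y, of x]
          by (simp add: blinfun.diff_left blinfun.diff_right)
        also have "\<bar>\<dots>\<bar> \<le> M * norm x * B * M\<^sub>0 * (\<sigma> - 0) * norm y"
          using L(2) XT \<sigma> by (intro duhamel_bound[OF T0 cont _ y] F M0(2)) auto
        finally show "\<bar>y ((T \<sigma> - T\<^sub>0 \<sigma>) x)\<bar> \<le> M * norm x * B * M\<^sub>0 * (\<sigma> - 0) * norm y" .
      qed
      then show "norm ((T \<sigma> - T\<^sub>0 \<sigma>) x) \<le> c * (M * B * M\<^sub>0) * \<sigma> * norm x" by (simp add: mult_ac)
    qed
  qed
qed

section \<open>Local characterisation of mild solutions\<close>

lemma constant_of_quadratic_increments:
  fixes p :: "real \<Rightarrow> real"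
  assumes C: "\<And>s h. 0 \<le> s \<Longrightarrow> 0 \<le> h \<Longrightarrow> s + h \<le> t \<Longrightarrow> \<bar>p (s + h) - p s\<bar> \<le> C * h\<^sup>2"
    and t: "t \<ge> 0"
  shows "p t = p 0"
proof -
  have "(p has_field_derivative 0) (at s within {0..t})" if s: "s \<in> {0..t}" for s
    unfolding has_field_derivative_iff
  proof (rule Lim_null_comparison)
    have "norm ((p r - p s) / (r - s)) \<le> C * \<bar>r - s\<bar>" if r: "r \<in> {0..t}" "r \<noteq> s" for r
    proof -
      have "\<bar>p r - p s\<bar> \<le> C * \<bar>r - s\<bar>\<^sup>2"
        using C[of s "r - s"] C[of r "s - r"] r s
        by (cases "s \<le> r") (auto simp: abs_minus_commute power2_commute)
      then show ?thesis using r by (simp add: abs_divide field_simps power2_eq_square)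
    qed
    then show "\<forall>\<^sub>F r in at s within {0..t}. norm ((p r - p s) / (r - s)) \<le> C * \<bar>r - s\<bar>"
      unfolding eventually_at_filter by (intro always_eventually) blast
    have "((\<lambda>r. C * \<bar>r - s\<bar>) \<longlongrightarrow> C * \<bar>s - s\<bar>) (at s within {0..t})" by (intro tendsto_intros)
    then show "((\<lambda>r. C * \<bar>r - s\<bar>) \<longlongrightarrow> 0) (at s within {0..t})" by simp
  qed
  then obtain c where "\<And>s. s \<in> {0..t} \<Longrightarrow> p s = c"
    using has_field_derivative_zero_constant[of "{0..t}" p] by auto
  then show ?thesis using t by simp
qed

text \<open>
  The defect is tested with \<open>y\<close> because its integral term is in general only an element of
  \<open>X\<^sup>\<odot>\<^sup>*\<close>.
\<close>

definition mild_defect :: "(real \<Rightarrow> 'a::real_normed_vector \<Rightarrow>\<^sub>L 'a) \<Rightarrow> (real \<Rightarrow> ('a \<Rightarrow>\<^sub>L real) lbfun) \<Rightarrow>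
    (real \<Rightarrow> 'a) \<Rightarrow> real \<Rightarrow> real \<Rightarrow> ('a \<Rightarrow>\<^sub>L real) \<Rightarrow> real"
  where "mild_defect T g u s h y = y (u (s + h)) - y (T h (u s)) - duhamel T g s (s + h) y"

definition small_defect :: "(real \<Rightarrow> 'a::real_normed_vector \<Rightarrow>\<^sub>L 'a) \<Rightarrow> (real \<Rightarrow> ('a \<Rightarrow>\<^sub>L real) lbfun) \<Rightarrow>
    (real \<Rightarrow> 'a) \<Rightarrow> real \<Rightarrow> bool"
  where "small_defect T g u a \<longleftrightarrow> (\<exists>C\<ge>0. \<forall>s\<ge>0. \<forall>h\<ge>0. s + h \<le> a \<longrightarrow>
    (\<forall>y\<in>sun_dual T. \<bar>mild_defect T g u s h y\<bar> \<le> C * h\<^sup>2 * norm y))"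

text \<open>
  By the semigroup law a solution satisfies the equation exactly between any two times. Conversely,
  follow \<open>u\<close> up to time \<open>s\<close> and continue from there with the variation-of-constants formula up to
  time \<open>t\<close>. The outcome, tested with \<open>y\<close>, is a function \<open>p\<close> of \<open>s\<close> whose increments are defects,
  so \<open>p\<close> is constant. Its values at \<open>s = t\<close> and \<open>s = 0\<close> are the two sides of the equation.
\<close>

lemma mild_solution_iff_small_defect:
  fixes T :: "real \<Rightarrow> 'a::banach \<Rightarrow>\<^sub>L 'a"
  assumes T: "C0_semigroup T" and a: "a \<ge> 0"
    and g: "continuous_on {0..a} g" "g ` {0..a} \<subseteq> sun_star_space T"
  shows "(\<forall>t\<in>{0..a}. \<forall>y\<in>sun_dual T. blinfun_apply y (u t) = blinfun_apply y (T t \<phi>) + duhamel T g 0 t y) \<longleftrightarrow>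
    u 0 = \<phi> \<and> small_defect T g u a" (is "?mild \<longleftrightarrow> _")
proof -
  have g_sub: "continuous_on A g" "g ` A \<subseteq> sun_star_space T" if "A \<subseteq> {0..a}" for A
    using g that by (blast intro: continuous_on_subset)+
  show ?thesis
  proof
    assume mild: ?mild
    have "u 0 = \<phi>"
    proof (rule sun_dual_separates[OF T])
      fix y assume "y \<in> sun_dual T"
      then show "y (u 0) = y \<phi>"
        using mild a C0_semigroup_zero[OF T] by (auto simp: duhamel_def dest!: bspec[of _ _ 0])
    qed
    moreover have "mild_defect T g u s h y = 0"
      if s: "0 \<le> s" "0 \<le> h" "s + h \<le> a" and y: "y \<in> sun_dual T" for s h y
    proof -
      have yh: "y o\<^sub>L T h \<in> sun_dual T" by (rule sun_dual_invariant[OF T y s(2)])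
      have "y (T h (u s)) = (y o\<^sub>L T h) (T s \<phi>) + duhamel T g 0 s (y o\<^sub>L T h)"
        using bspec[OF bspec[OF mild, of s] yh] s by simp
      moreover have "(y o\<^sub>L T h) (T s \<phi>) = y (T (s + h) \<phi>)"
        using C0_semigroup_add[OF T s(2,1)] by (simp add: add.commute)
      moreover have "duhamel T g 0 (s + h) y = duhamel T g 0 s (y o\<^sub>L T h) + duhamel T g s (s + h) y"
        using duhamel_split[OF T g_sub(1,2) y s(1), of "s + h"] s by simp
      moreover have "y (u (s + h)) = y (T (s + h) \<phi>) + duhamel T g 0 (s + h) y"
        using mild y s by auto
      ultimately show ?thesis by (simp add: mild_defect_def)
    qed
    ultimately show "u 0 = \<phi> \<and> small_defect T g u a"
      unfolding small_defect_def by (auto intro!: exI[of _ 0])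
  next
    assume rhs: "u 0 = \<phi> \<and> small_defect T g u a"
    then obtain C where C: "C \<ge> 0" "\<And>s h y. 0 \<le> s \<Longrightarrow> 0 \<le> h \<Longrightarrow> s + h \<le> a \<Longrightarrow> y \<in> sun_dual T \<Longrightarrow>
        \<bar>mild_defect T g u s h y\<bar> \<le> C * h\<^sup>2 * norm y"
      unfolding small_defect_def by blast
    obtain M where M: "M \<ge> 1" "\<And>t. 0 \<le> t \<Longrightarrow> t \<le> a \<Longrightarrow> norm (T t) \<le> M"
      using C0_semigroup_bounded[OF T] by blast
    show ?mild
    proof (intro ballI)
      fix t y assume t: "t \<in> {0..a}" and y: "y \<in> sun_dual T"
      define p where "p s = y (T (t - s) (u s)) + duhamel T g s t y" for s
      have "p t = p 0"
      proof (rule constant_of_quadratic_increments)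
        fix s h assume s: "0 \<le> s" "0 \<le> h" "s + h \<le> t"
        let ?z = "y o\<^sub>L T (t - (s + h))"
        have z: "?z \<in> sun_dual T" using s by (intro sun_dual_invariant[OF T y]) simp
        have "T (t - s) = T (t - (s + h)) o\<^sub>L T h"
          using C0_semigroup_add[OF T, of "t - (s + h)" h] s by simp
        moreover have "duhamel T g s t y = duhamel T g s (s + h) ?z + duhamel T g (s + h) t y"
          using s t by (intro duhamel_split[OF T g_sub y]) auto
        ultimately have "p (s + h) - p s = mild_defect T g u s h ?z"
          by (simp add: p_def mild_defect_def)
        also have "\<bar>\<dots>\<bar> \<le> C * h\<^sup>2 * norm ?z" using s t by (intro C(2) z) auto
        also have "\<dots> \<le> C * h\<^sup>2 * (norm y * M)"
          using C(1) s t M(2) by (intro mult_left_mono order_trans[OF norm_blinfun_compose]) auto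
        finally show "\<bar>p (s + h) - p s\<bar> \<le> (C * norm y * M) * h\<^sup>2" by (simp add: mult_ac)
      qed (use t in simp)
      then show "y (u t) = y (T t \<phi>) + duhamel T g 0 t y"
        using rhs C0_semigroup_zero[OF T] by (simp add: p_def duhamel_def)
    qed
  qed
qed

text \<open>
  The integral over \<open>{s..s + h}\<close> is \<open>O(h)\<close>, so \<open>u\<close> follows the semigroup to first order. This is
  the a priori estimate that makes the defects of the two equations comparable.
\<close>

lemma small_defect_increment:
  fixes T :: "real \<Rightarrow> 'a::banach \<Rightarrow>\<^sub>L 'a"
  assumes T: "C0_semigroup T" and a: "a \<ge> 0"
    and g: "continuous_on {0..a} g" "g ` {0..a} \<subseteq> sun_star_space T" and u: "small_defect T g u a"
  obtains c where "c \<ge> 0"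
    "\<And>s h. 0 \<le> s \<Longrightarrow> 0 \<le> h \<Longrightarrow> s + h \<le> a \<Longrightarrow> norm (u (s + h) - T h (u s)) \<le> c * h"
proof -
  obtain C where C: "C \<ge> 0" "\<And>s h y. 0 \<le> s \<Longrightarrow> 0 \<le> h \<Longrightarrow> s + h \<le> a \<Longrightarrow> y \<in> sun_dual T \<Longrightarrow>
      \<bar>mild_defect T g u s h y\<bar> \<le> C * h\<^sup>2 * norm y"
    using u unfolding small_defect_def by blast
  obtain M where M: "M \<ge> 1" "\<And>t. 0 \<le> t \<Longrightarrow> t \<le> a \<Longrightarrow> norm (T t) \<le> M"
    using C0_semigroup_bounded[OF T] by blast
  have "bounded (g ` {0..a})" by (intro compact_imp_bounded compact_continuous_image g) simp
  then obtain F where F: "\<And>\<tau>. 0 \<le> \<tau> \<Longrightarrow> \<tau> \<le> a \<Longrightarrow> norm (g \<tau>) \<le> F"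
    unfolding bounded_iff by (metis atLeastAtMost_iff imageI)
  have F0: "0 \<le> F" using F[of 0] a norm_ge_zero[of "g 0"] by linarith
  obtain K where K: "K \<ge> 0"
    "\<And>v c. c \<ge> 0 \<Longrightarrow> (\<And>y. y \<in> sun_dual T \<Longrightarrow> \<bar>y v\<bar> \<le> c * norm y) \<Longrightarrow> norm v \<le> K * c"
    using sun_dual_norming[OF T] by metis
  have CFM: "C * a + F * M \<ge> 0" using C(1) a F0 M(1) by simp
  show ?thesis
  proof (rule that)
    show "K * (C * a + F * M) \<ge> 0" using K(1) CFM by simp
    fix s h assume s: "0 \<le> s" "0 \<le> h" "s + h \<le> a"
    have "norm (u (s + h) - T h (u s)) \<le> K * ((C * a + F * M) * h)"
    proof (rule K(2))
      show "0 \<le> (C * a + F * M) * h" using CFM s by simp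
      fix y assume y: "y \<in> sun_dual T"
      have "y (u (s + h) - T h (u s)) = mild_defect T g u s h y + duhamel T g s (s + h) y"
        by (simp add: mild_defect_def blinfun.diff_right)
      moreover have "\<bar>mild_defect T g u s h y\<bar> \<le> C * a * h * norm y"
      proof -
        have "C * (h * h) * norm y \<le> C * (a * h) * norm y"
          using C(1) s by (intro mult_left_mono mult_right_mono) auto
        then show ?thesis using C(2)[OF s y] by (simp add: power2_eq_square mult_ac)
      qed
      moreover have "\<bar>duhamel T g s (s + h) y\<bar> \<le> F * M * (s + h - s) * norm y"
      proof (rule duhamel_bound[OF T _ _ y])
        show "continuous_on {s..s + h} g" using s by (intro continuous_on_subset[OF g(1)]) auto
        show "g ` {s..s + h} \<subseteq> sun_star_space T" using s g(2) by auto
      qed (use s F M in auto)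
      ultimately show "\<bar>y (u (s + h) - T h (u s))\<bar> \<le> (C * a + F * M) * h * norm y"
        by (simp add: algebra_simps)
    qed
    then show "norm (u (s + h) - T h (u s)) \<le> K * (C * a + F * M) * h" by (simp add: mult_ac)
  qed
qed

text \<open>
  The two defects differ by \<open>\<integral> T\<^sub>0\<^sup>\<odot>\<^sup>*(h - \<tau>) L (u (s + \<tau>) - T \<tau> (u s)) d\<tau>\<close> and by the
  effect of exchanging \<open>T\<^sub>0\<close> for \<open>T\<close> in the integral of \<open>f\<close>. Both are integrals over an
  interval of length \<open>h\<close> of a quantity that is itself \<open>O(h)\<close>.
\<close>

lemma small_defect_perturbation_iff:
  fixes T\<^sub>0 T :: "real \<Rightarrow> 'a::banach \<Rightarrow>\<^sub>L 'a"
  assumes T0: "C0_semigroup T\<^sub>0" and X: "admissible_range T\<^sub>0 \<X>"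
    and L: "bounded_linear L" "range L \<subseteq> \<X>" and P: "perturbed_semigroup T\<^sub>0 L T"
    and a: "a \<ge> 0" and u: "continuous_on {0..a} u"
    and f: "continuous_on {0..a} f" "f ` {0..a} \<subseteq> \<X>"
  shows "small_defect T\<^sub>0 (\<lambda>\<tau>. L (u \<tau>) + f \<tau>) u a \<longleftrightarrow> small_defect T f u a"
proof -
  have T: "C0_semigroup T" using P by (simp add: perturbed_semigroup_def)
  have V: "sun_dual T = sun_dual T\<^sub>0"
    using perturbed_semigroup_close[OF T0 X L P, of 1] sun_dual_eq_of_close[of T T\<^sub>0] by metis
  have XT: "\<X> \<subseteq> sun_star_space T\<^sub>0" "\<X> \<subseteq> sun_star_space T"
    using X V by (auto simp: admissible_range_def sun_star_space_def)
  have subX: "subspace \<X>" using X by (simp add: admissible_range_def)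
  obtain C where C: "C \<ge> 0" "\<And>\<sigma>. 0 \<le> \<sigma> \<Longrightarrow> \<sigma> \<le> a \<Longrightarrow> norm (T \<sigma> - T\<^sub>0 \<sigma>) \<le> C * \<sigma>"
    using perturbed_semigroup_close[OF T0 X L P] by blast
  obtain M where M: "M \<ge> 1" "\<And>t. 0 \<le> t \<Longrightarrow> t \<le> a \<Longrightarrow> norm (T\<^sub>0 t) \<le> M"
    using C0_semigroup_bounded[OF T0] by blast
  obtain B where B: "B \<ge> 0" "\<And>x. norm (L x) \<le> norm x * B"
    using bounded_linear.nonneg_bounded[OF L(1)] by blast
  have "bounded (f ` {0..a})" by (intro compact_imp_bounded compact_continuous_image f) simp
  then obtain F where F: "\<And>\<tau>. 0 \<le> \<tau> \<Longrightarrow> \<tau> \<le> a \<Longrightarrow> norm (f \<tau>) \<le> F"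
    unfolding bounded_iff by (metis atLeastAtMost_iff imageI)
  have F0: "0 \<le> F" using F[of 0] a norm_ge_zero[of "f 0"] by linarith
  have "bounded (u ` {0..a})" by (intro compact_imp_bounded compact_continuous_image u) simp
  then obtain U where U: "\<And>\<tau>. 0 \<le> \<tau> \<Longrightarrow> \<tau> \<le> a \<Longrightarrow> norm (u \<tau>) \<le> U"
    unfolding bounded_iff by (metis atLeastAtMost_iff imageI)
  have U0: "0 \<le> U" using U[of 0] a norm_ge_zero[of "u 0"] by linarith
  let ?g = "\<lambda>\<tau>. L (u \<tau>) + f \<tau>"
  have Lu: "continuous_on {0..a} (\<lambda>\<tau>. L (u \<tau>))" by (rule bounded_linear.continuous_on[OF L(1) u])
  have g: "continuous_on {0..a} ?g" "?g ` {0..a} \<subseteq> \<X>"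
  proof -
    show "continuous_on {0..a} ?g" by (intro continuous_on_add Lu f)
    show "?g ` {0..a} \<subseteq> \<X>" using subspace_add[OF subX] L(2) f(2) by blast
  qed
  have diff: "\<bar>mild_defect T\<^sub>0 ?g u s h y - mild_defect T f u s h y\<bar> \<le> (B * c * M + F * C) * h\<^sup>2 * norm y"
    if c: "c \<ge> 0" "\<And>s h. 0 \<le> s \<Longrightarrow> 0 \<le> h \<Longrightarrow> s + h \<le> a \<Longrightarrow> norm (u (s + h) - T h (u s)) \<le> c * h"
      and s: "0 \<le> s" "0 \<le> h" "s + h \<le> a" and y: "y \<in> sun_dual T\<^sub>0" for c s h y
  proof -
    let ?I = "{s..s + h}"
    have I: "?I \<subseteq> {0..a}" using s by auto
    let ?Lu = "\<lambda>\<tau>. L (u (s + \<tau>))" and ?LT = "\<lambda>\<tau>. L (T \<tau> (u s))"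
    have cu: "continuous_on {0..h} (\<lambda>\<tau>. u (s + \<tau>))"
      using s by (intro continuous_on_compose2[OF u] continuous_intros) auto
    have cT: "continuous_on {0..h} (\<lambda>\<tau>. T \<tau> (u s))"
      by (rule continuous_on_subset[OF C0_semigroup_orbit_continuous[OF T]]) auto
    have cLu: "continuous_on {0..h} ?Lu" and cLT: "continuous_on {0..h} ?LT"
      by (rule bounded_linear.continuous_on[OF L(1)] cu cT)+
    have rL: "?Lu ` {0..h} \<subseteq> sun_star_space T\<^sub>0" "?LT ` {0..h} \<subseteq> sun_star_space T\<^sub>0"
      "(\<lambda>\<tau>. L (u \<tau>)) ` ?I \<subseteq> sun_star_space T\<^sub>0"
      using L(2) XT by blast+
    have rf: "f ` ?I \<subseteq> sun_star_space T\<^sub>0" using f(2) I XT by blast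
    have cf: "continuous_on ?I f" by (rule continuous_on_subset[OF f(1) I])
    have "y (T h (u s)) = y (T\<^sub>0 h (u s)) + duhamel T\<^sub>0 ?LT 0 h y"
      by (rule perturbed_semigroup_variation_of_constants[OF T0 X L P s(2) y])
    moreover have "duhamel T\<^sub>0 ?g s (s + h) y = duhamel T\<^sub>0 (\<lambda>\<tau>. L (u \<tau>)) s (s + h) y + duhamel T\<^sub>0 f s (s + h) y"
      by (rule duhamel_add[OF T0 continuous_on_subset[OF Lu I] rL(3) cf rf y])
    moreover have "duhamel T\<^sub>0 (\<lambda>\<tau>. L (u \<tau>)) s (s + h) y = duhamel T\<^sub>0 ?Lu 0 h y"
      using duhamel_shift[of T\<^sub>0 "\<lambda>\<tau>. L (u \<tau>)" s 0 h y] by simp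
    moreover have "\<bar>duhamel T\<^sub>0 ?Lu 0 h y - duhamel T\<^sub>0 ?LT 0 h y\<bar> \<le> B * c * M * h\<^sup>2 * norm y"
    proof -
      let ?D = "\<lambda>\<tau>. L (u (s + \<tau>) - T \<tau> (u s))"
      have cD: "continuous_on {0..h} ?D"
        by (intro bounded_linear.continuous_on[OF L(1)] continuous_on_diff cu cT)
      have rD: "?D ` {0..h} \<subseteq> sun_star_space T\<^sub>0" using L(2) XT by blast
      have "?Lu = (\<lambda>\<tau>. ?D \<tau> + ?LT \<tau>)"
        by (simp add: linear_diff[OF bounded_linear.linear[OF L(1)]])
      then have "duhamel T\<^sub>0 ?Lu 0 h y - duhamel T\<^sub>0 ?LT 0 h y = duhamel T\<^sub>0 ?D 0 h y"
        using duhamel_add[OF T0 cD rD cLT rL(2) y] by simp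
      also have "\<bar>\<dots>\<bar> \<le> (B * c * h) * M * (h - 0) * norm y"
      proof (rule duhamel_bound[OF T0 cD rD y])
        fix \<tau> assume \<tau>: "0 \<le> \<tau>" "\<tau> \<le> h"
        have "norm (u (s + \<tau>) - T \<tau> (u s)) \<le> c * \<tau>" using c(2) s \<tau> by simp
        also have "\<dots> \<le> c * h" using c(1) \<tau> by (intro mult_left_mono)
        finally have "norm (u (s + \<tau>) - T \<tau> (u s)) * B \<le> c * h * B" using B(1) by (rule mult_right_mono)
        then show "norm (?D \<tau>) \<le> B * c * h"
          using B(2)[of "u (s + \<tau>) - T \<tau> (u s)"] by (simp add: mult_ac)
      qed (use s M(2) in auto)
      finally show ?thesis by (simp add: power2_eq_square mult_ac)
    qed
    moreover have "\<bar>duhamel T f s (s + h) y - duhamel T\<^sub>0 f s (s + h) y\<bar> \<le> F * C * (s + h - s)\<^sup>2 * norm y"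
      by (rule duhamel_diff_semigroup[OF T T0 V cf rf y]) (use s F C in auto)
    ultimately show ?thesis by (simp add: mild_defect_def algebra_simps)
  qed
  have transfer: "small_defect T\<^sub>0 ?g u a \<longleftrightarrow> small_defect T f u a"
    if c: "c \<ge> 0" "\<And>s h. 0 \<le> s \<Longrightarrow> 0 \<le> h \<Longrightarrow> s + h \<le> a \<Longrightarrow> norm (u (s + h) - T h (u s)) \<le> c * h" for c
  proof -
    define K where "K = B * c * M + F * C"
    have K: "K \<ge> 0" using B(1) c(1) M(1) F0 C(1) by (simp add: K_def)
    have d: "\<bar>p\<bar> \<le> (E + K) * h\<^sup>2 * norm y"
      if "\<bar>q\<bar> \<le> E * h\<^sup>2 * norm y" "\<bar>p - q\<bar> \<le> K * h\<^sup>2 * norm y" for p q E h :: real and y :: "'a \<Rightarrow>\<^sub>L real"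
      using that by (simp add: algebra_simps)
    show ?thesis
    proof
      assume "small_defect T\<^sub>0 ?g u a"
      then obtain E where E: "E \<ge> 0" "\<And>s h y. 0 \<le> s \<Longrightarrow> 0 \<le> h \<Longrightarrow> s + h \<le> a \<Longrightarrow> y \<in> sun_dual T\<^sub>0 \<Longrightarrow>
          \<bar>mild_defect T\<^sub>0 ?g u s h y\<bar> \<le> E * h\<^sup>2 * norm y"
        unfolding small_defect_def by blast
      have "\<bar>mild_defect T f u s h y\<bar> \<le> (E + K) * h\<^sup>2 * norm y"
        if "0 \<le> s" "0 \<le> h" "s + h \<le> a" "y \<in> sun_dual T" for s h y
        using that V by (intro d[OF E(2)]) (auto simp: K_def abs_minus_commute[of "mild_defect T f u s h y"] intro!: diff c)
      then show "small_defect T f u a"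
        unfolding small_defect_def using E(1) K by (intro exI[of _ "E + K"]) simp
    next
      assume "small_defect T f u a"
      then obtain E where E: "E \<ge> 0" "\<And>s h y. 0 \<le> s \<Longrightarrow> 0 \<le> h \<Longrightarrow> s + h \<le> a \<Longrightarrow> y \<in> sun_dual T \<Longrightarrow>
          \<bar>mild_defect T f u s h y\<bar> \<le> E * h\<^sup>2 * norm y"
        unfolding small_defect_def by blast
      have "\<bar>mild_defect T\<^sub>0 ?g u s h y\<bar> \<le> (E + K) * h\<^sup>2 * norm y"
        if "0 \<le> s" "0 \<le> h" "s + h \<le> a" "y \<in> sun_dual T\<^sub>0" for s h y
        using that V by (intro d[OF E(2)]) (auto simp: K_def intro!: diff c)
      then show "small_defect T\<^sub>0 ?g u a"
        unfolding small_defect_def using E(1) K by (intro exI[of _ "E + K"]) simp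
    qed
  qed
  show ?thesis
  proof
    assume sd: "small_defect T\<^sub>0 ?g u a"
    obtain c where c: "c \<ge> 0"
      "\<And>s h. 0 \<le> s \<Longrightarrow> 0 \<le> h \<Longrightarrow> s + h \<le> a \<Longrightarrow> norm (u (s + h) - T\<^sub>0 h (u s)) \<le> c * h"
      using small_defect_increment[OF T0 a g(1) order_trans[OF g(2) XT(1)] sd] by blast
    \<comment> \<open>Pass from \<open>T\<^sub>0\<close> to \<open>T\<close>, which is \<open>O(h)\<close>-close.\<close>
    have "norm (u (s + h) - T h (u s)) \<le> (c + C * U) * h" if s: "0 \<le> s" "0 \<le> h" "s + h \<le> a" for s h
    proof -
      have "norm ((T h - T\<^sub>0 h) (u s)) \<le> norm (T h - T\<^sub>0 h) * norm (u s)" by (rule norm_blinfun)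
      also have "\<dots> \<le> C * h * U" using s C U by (intro mult_mono) auto
      finally have "norm (T h (u s) - T\<^sub>0 h (u s)) \<le> C * h * U" by (simp add: blinfun.diff_left)
      moreover have "norm (u (s + h) - T h (u s)) \<le>
          norm (u (s + h) - T\<^sub>0 h (u s)) + norm (T h (u s) - T\<^sub>0 h (u s))"
        using norm_triangle_ineq4[of "u (s + h) - T\<^sub>0 h (u s)" "T h (u s) - T\<^sub>0 h (u s)"] by simp
      ultimately show ?thesis using c(2)[OF s] by (simp add: algebra_simps)
    qed
    with sd show "small_defect T f u a"
      using transfer[of "c + C * U"] c(1) C(1) U0 by simp
  next
    assume sd: "small_defect T f u a"
    obtain c where "c \<ge> 0"
      "\<And>s h. 0 \<le> s \<Longrightarrow> 0 \<le> h \<Longrightarrow> s + h \<le> a \<Longrightarrow> norm (u (s + h) - T h (u s)) \<le> c * h"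
      using small_defect_increment[OF T a f(1) order_trans[OF f(2) XT(2)] sd] by blast
    with sd show "small_defect T\<^sub>0 ?g u a" using transfer by simp
  qed
qed

text \<open>
  Admissibility makes \<open>j\<close> invertible at the integral. For \<open>S = T\<close> this is the equation of the
  unperturbed semigroup, and for the perturbed semigroup \<open>S\<close> that of the linearised problem.
\<close>

lemma integral_equation_iff_mild:
  fixes S T :: "real \<Rightarrow> 'a::banach \<Rightarrow>\<^sub>L 'a"
  assumes S: "C0_semigroup S" and T: "C0_semigroup T" and V: "sun_dual S = sun_dual T"
    and X: "admissible_range T \<X>"
    and C: "C \<ge> 0" "b > 0" "\<And>\<sigma>. 0 \<le> \<sigma> \<Longrightarrow> \<sigma> \<le> b \<Longrightarrow> norm (S \<sigma> - T \<sigma>) \<le> C * \<sigma>"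
    and t: "t \<ge> 0" and g: "continuous_on {0..t} g" "g ` {0..t} \<subseteq> \<X>"
  shows "x = S t \<phi> + inv (sun_embed T) (weak_star_integral 0 t (\<lambda>\<tau>. sun_star S (t - \<tau>) (g \<tau>))) \<longleftrightarrow>
    (\<forall>y\<in>sun_dual T. blinfun_apply y x = blinfun_apply y (S t \<phi>) + duhamel S g 0 t y)"
proof -
  obtain w where w: "\<And>y. y \<in> sun_dual T \<Longrightarrow> blinfun_apply y w = duhamel S g 0 t y"
    using admissible_range_nearby_semigroup[OF S T V X C t g] by blast
  have "inv (sun_embed T) (weak_star_integral 0 t (\<lambda>\<tau>. sun_star S (t - \<tau>) (g \<tau>))) = w"
    by (rule inv_sun_embed_weak_star_integral[OF T V w])
  moreover have "x = S t \<phi> + w \<longleftrightarrow>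
      (\<forall>y\<in>sun_dual T. blinfun_apply y x = blinfun_apply y (S t \<phi>) + duhamel S g 0 t y)"
    using sun_dual_separates[OF T, of x "S t \<phi> + w"] w by (auto simp: blinfun.add_right)
  ultimately show ?thesis by simp
qed

section \<open>Linearisation of the integral equation\<close>

lemma class_Ck_has_derivative:
  assumes "class_Ck k f" "k \<ge> 1"
  obtains f' where "(f has_derivative f') (at x)"
proof -
  obtain D where D0: "\<forall>x. D 0 x [] = f x"
    and ml: "\<forall>n\<le>k. \<forall>x. bounded_multilinear n (D n x)"
    and der: "\<forall>n<k. \<forall>x. \<forall>e>0. \<exists>d>0. \<forall>h. norm h < d \<longrightarrow> (\<forall>vs. length vs = n \<longrightarrow>
       norm (D n (x + h) vs - D n x vs - D (Suc n) x (h # vs)) \<le> e * norm h * prod_list (map norm vs))"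
    using assms(1) unfolding class_Ck_def by (elim exE conjE) (rule that)
  have m: "bounded_multilinear 1 (D 1 x)" using ml assms(2) by simp
  then obtain K where K: "\<And>vs. length vs = 1 \<Longrightarrow> norm (D 1 x vs) \<le> K * prod_list (map norm vs)"
    unfolding bounded_multilinear_def by blast
  have "linear (\<lambda>v. D 1 x ([0][0 := v]))"
    using conjunct1[OF m[unfolded bounded_multilinear_def], rule_format, of "[0]" 0] by simp
  moreover have "norm (D 1 x [v]) \<le> norm v * K" for v
    using K[of "[v]"] by (simp add: mult.commute)
  ultimately have bl: "bounded_linear (\<lambda>v. D 1 x [v])"
    unfolding bounded_linear_def bounded_linear_axioms_def by auto
  have "(f has_derivative (\<lambda>v. D 1 x [v])) (at x)"
    unfolding has_derivative_at_alt
  proof (intro conjI bl allI impI)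
    fix e :: real assume "e > 0"
    then obtain d where "d > 0" "\<And>h. norm h < d \<Longrightarrow> norm (f (x + h) - f x - D 1 x [h]) \<le> e * norm h"
      using der[rule_format, of 0 e x] assms(2) D0 by auto
    then show "\<exists>d>0. \<forall>y. norm (y - x) < d \<longrightarrow> norm (f y - f x - D 1 x [y - x]) \<le> e * norm (y - x)"
      by (intro exI[of _ d]) (metis add.commute diff_add_cancel)
  qed
  then show ?thesis by (rule that)
qed

text \<open>
  So the linear and the nonlinear part of a differentiable admissible perturbation both take values in the same
  admissible range.
\<close>

lemma derivative_in_closed_subspace:
  fixes f :: "'a::real_normed_vector \<Rightarrow> 'b::real_normed_vector"
  assumes f: "(f has_derivative f') (at x)" and W: "subspace W" "closed W" and "range f \<subseteq> W"
  shows "f' v \<in> W"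
proof -
  have "((\<lambda>r. x + r *\<^sub>R v) has_derivative (\<lambda>r. r *\<^sub>R v)) (at (0::real))"
    by (auto intro!: derivative_eq_intros)
  moreover have "(f has_derivative f') (at (x + 0 *\<^sub>R v))" using f by simp
  ultimately have "((\<lambda>r. f (x + r *\<^sub>R v)) has_derivative (\<lambda>r. f' (r *\<^sub>R v))) (at (0::real))"
    by (rule has_derivative_compose)
  moreover have "(\<lambda>r. f' (r *\<^sub>R v)) = (\<lambda>r. r *\<^sub>R f' v)"
    using linear_scale[OF has_derivative_linear[OF f]] by auto
  ultimately have "((\<lambda>r. norm (f (x + r *\<^sub>R v) - f x - r *\<^sub>R f' v) / \<bar>r\<bar>) \<longlongrightarrow> 0) (at 0)"
    by (simp add: has_derivative_at)
  then have "((\<lambda>r. norm ((f (x + r *\<^sub>R v) - f x) /\<^sub>R r - f' v)) \<longlongrightarrow> 0) (at 0)"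
  proof (rule Lim_transform_eventually)
    have "norm (f (x + r *\<^sub>R v) - f x - r *\<^sub>R f' v) / \<bar>r\<bar> = norm ((f (x + r *\<^sub>R v) - f x) /\<^sub>R r - f' v)"
      if "r \<noteq> 0" for r
    proof -
      have "(f (x + r *\<^sub>R v) - f x) /\<^sub>R r - f' v = (f (x + r *\<^sub>R v) - f x - r *\<^sub>R f' v) /\<^sub>R r"
        using that by (simp add: scaleR_diff_right)
      then show ?thesis by (simp add: divide_inverse_commute abs_inverse)
    qed
    then show "\<forall>\<^sub>F r in at 0. norm (f (x + r *\<^sub>R v) - f x - r *\<^sub>R f' v) / \<bar>r\<bar> =
        norm ((f (x + r *\<^sub>R v) - f x) /\<^sub>R r - f' v)"
      unfolding eventually_at_filter by (intro always_eventually) blast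
  qed
  then have "((\<lambda>r. (f (x + r *\<^sub>R v) - f x) /\<^sub>R r) \<longlongrightarrow> f' v) (at 0)"
    by (rule LIM_zero_cancel[OF tendsto_norm_zero_cancel])
  then show ?thesis
  proof (rule Lim_in_closed_set[OF W(2), rotated 2])
    show "\<forall>\<^sub>F r in at 0. (f (x + r *\<^sub>R v) - f x) /\<^sub>R r \<in> W"
      using assms(4) by (intro always_eventually allI subspace_scale subspace_diff W(1)) auto
  qed simp
qed

theorem proposition24:
  fixes T\<^sub>0 T :: "real \<Rightarrow> 'a::banach \<Rightarrow>\<^sub>L 'a"
    and G L R :: "'a \<Rightarrow> ('a \<Rightarrow>\<^sub>L real) lbfun"
    and k :: nat and t\<^sub>e :: ereal and \<phi> :: 'a and u :: "real \<Rightarrow> 'a"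
  assumes "C0_semigroup T\<^sub>0"
    and "admissible_perturbation T\<^sub>0 G"
    and "k \<ge> 1" and "class_Ck k G"
    and "G 0 = 0"
    and "L = frechet_derivative G (at 0)"
    and "R = (\<lambda>x. G x - L x)"
    and "perturbed_semigroup T\<^sub>0 L T"
    and "0 < t\<^sub>e"
    and "continuous_on {t. 0 \<le> t \<and> ereal t < t\<^sub>e} u"
  shows "(\<forall>t. 0 \<le> t \<and> ereal t < t\<^sub>e \<longrightarrow>
            u t = blinfun_apply (T\<^sub>0 t) \<phi> +
              inv (sun_embed T\<^sub>0) (weak_star_integral 0 t (\<lambda>\<tau>. sun_star T\<^sub>0 (t - \<tau>) (G (u \<tau>))))) \<longleftrightarrow>
         (\<forall>t. 0 \<le> t \<and> ereal t < t\<^sub>e \<longrightarrow>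
            u t = blinfun_apply (T t) \<phi> +
              inv (sun_embed T\<^sub>0) (weak_star_integral 0 t (\<lambda>\<tau>. sun_star T (t - \<tau>) (R (u \<tau>)))))"
proof -
  let ?J = "{t. 0 \<le> t \<and> ereal t < t\<^sub>e}"
  note T0 = assms(1) and P = assms(8)
  obtain \<X> where X: "admissible_range T\<^sub>0 \<X>" and GX: "range G \<subseteq> \<X>" and G: "continuous_on UNIV G"
    using assms(2) unfolding admissible_perturbation_def by blast
  have subX: "subspace \<X>" "closed \<X>" using X by (simp_all add: admissible_range_def)
  obtain G' where G': "(G has_derivative G') (at 0)" using class_Ck_has_derivative[OF assms(4,3)] .
  have L_eq: "L = G'" unfolding assms(6) using frechet_derivative_at[OF G'] by simp
  have L: "bounded_linear L" "range L \<subseteq> \<X>"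
    unfolding L_eq using derivative_in_closed_subspace[OF G' subX GX] has_derivative_bounded_linear[OF G'] by auto
  have R: "continuous_on UNIV R" "range R \<subseteq> \<X>"
  proof -
    show "continuous_on UNIV R"
      unfolding assms(7) by (rule continuous_on_diff[OF G linear_continuous_on[OF L(1)]])
    show "range R \<subseteq> \<X>"
      unfolding assms(7) using GX L(2) by (auto intro!: subspace_diff[OF subX(1)])
  qed
  have T: "C0_semigroup T" using P by (simp add: perturbed_semigroup_def)
  obtain C where C: "C \<ge> 0" "\<And>\<sigma>. 0 \<le> \<sigma> \<Longrightarrow> \<sigma> \<le> 1 \<Longrightarrow> norm (T \<sigma> - T\<^sub>0 \<sigma>) \<le> C * \<sigma>"
    using perturbed_semigroup_close[OF T0 X L P] by blast
  have V: "sun_dual T = sun_dual T\<^sub>0" by (rule sun_dual_eq_of_close) (rule C(2))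
  have XT: "\<X> \<subseteq> sun_star_space T\<^sub>0" "\<X> \<subseteq> sun_star_space T"
    using X V by (auto simp: admissible_range_def sun_star_space_def)
  let ?eq_unpert = "\<lambda>t. u t = T\<^sub>0 t \<phi> +
      inv (sun_embed T\<^sub>0) (weak_star_integral 0 t (\<lambda>\<tau>. sun_star T\<^sub>0 (t - \<tau>) (G (u \<tau>))))"
  let ?eq_pert = "\<lambda>t. u t = T t \<phi> +
      inv (sun_embed T\<^sub>0) (weak_star_integral 0 t (\<lambda>\<tau>. sun_star T (t - \<tau>) (R (u \<tau>))))"
  have J: "t \<in> ?J" if "a \<in> ?J" "t \<in> {0..a}" for t a
    using that by (auto intro: le_less_trans[of "ereal t" "ereal a"])
  \<comment> \<open>On a compact interval the constants in the estimates are uniform.\<close>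
  have "(\<forall>t\<in>{0..a}. ?eq_unpert t) \<longleftrightarrow> (\<forall>t\<in>{0..a}. ?eq_pert t)" if a: "a \<in> ?J" for a
  proof -
    have u: "continuous_on {0..a} u" using J[OF a] by (intro continuous_on_subset[OF assms(10)]) blast
    have Gu: "continuous_on {0..a} (\<lambda>\<tau>. G (u \<tau>))" "(\<lambda>\<tau>. G (u \<tau>)) ` A \<subseteq> \<X>"
      and Ru: "continuous_on {0..a} (\<lambda>\<tau>. R (u \<tau>))" "(\<lambda>\<tau>. R (u \<tau>)) ` A \<subseteq> \<X>" for A
      using GX R(2) by (auto intro: continuous_on_compose2[OF G u] continuous_on_compose2[OF R(1) u])
    have GLR: "(\<lambda>\<tau>. G (u \<tau>)) = (\<lambda>\<tau>. L (u \<tau>) + R (u \<tau>))" by (simp add: assms(7))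
    have a0: "a \<ge> 0" using a by simp
    have "(\<forall>t\<in>{0..a}. ?eq_unpert t) \<longleftrightarrow> (\<forall>t\<in>{0..a}. \<forall>y\<in>sun_dual T\<^sub>0.
        blinfun_apply y (u t) = blinfun_apply y (T\<^sub>0 t \<phi>) + duhamel T\<^sub>0 (\<lambda>\<tau>. G (u \<tau>)) 0 t y)"
    proof (rule ball_cong[OF refl])
      fix t assume t: "t \<in> {0..a}"
      show "?eq_unpert t \<longleftrightarrow> (\<forall>y\<in>sun_dual T\<^sub>0.
        blinfun_apply y (u t) = blinfun_apply y (T\<^sub>0 t \<phi>) + duhamel T\<^sub>0 (\<lambda>\<tau>. G (u \<tau>)) 0 t y)"
        using t by (intro integral_equation_iff_mild[OF T0 T0 refl X, of 0 1] Gu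
            continuous_on_subset[OF Gu(1)]) auto
    qed
    also have "\<dots> \<longleftrightarrow> u 0 = \<phi> \<and> small_defect T\<^sub>0 (\<lambda>\<tau>. G (u \<tau>)) u a"
      by (rule mild_solution_iff_small_defect[OF T0 a0 Gu(1) order_trans[OF Gu(2) XT(1)]])
    also have "\<dots> \<longleftrightarrow> u 0 = \<phi> \<and> small_defect T (\<lambda>\<tau>. R (u \<tau>)) u a"
      unfolding GLR using small_defect_perturbation_iff[OF T0 X L P a0 u Ru] by simp
    also have "\<dots> \<longleftrightarrow> (\<forall>t\<in>{0..a}. \<forall>y\<in>sun_dual T\<^sub>0.
        blinfun_apply y (u t) = blinfun_apply y (T t \<phi>) + duhamel T (\<lambda>\<tau>. R (u \<tau>)) 0 t y)"
      using mild_solution_iff_small_defect[OF T a0 Ru(1) order_trans[OF Ru(2) XT(2)]] V by simp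
    also have "\<dots> \<longleftrightarrow> (\<forall>t\<in>{0..a}. ?eq_pert t)"
    proof (rule ball_cong[OF refl])
      fix t assume t: "t \<in> {0..a}"
      show "(\<forall>y\<in>sun_dual T\<^sub>0.
        blinfun_apply y (u t) = blinfun_apply y (T t \<phi>) + duhamel T (\<lambda>\<tau>. R (u \<tau>)) 0 t y) \<longleftrightarrow> ?eq_pert t"
        using t C by (intro integral_equation_iff_mild[OF T T0 V X, of C 1, symmetric] Ru
            continuous_on_subset[OF Ru(1)]) auto
    qed
    finally show ?thesis .
  qed
  then have "(\<forall>a\<in>?J. \<forall>t\<in>{0..a}. ?eq_unpert t) \<longleftrightarrow> (\<forall>a\<in>?J. \<forall>t\<in>{0..a}. ?eq_pert t)"
    by (rule ball_cong[OF refl])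
  moreover have J_ball: "(\<forall>t. 0 \<le> t \<and> ereal t < t\<^sub>e \<longrightarrow> Q t) \<longleftrightarrow> (\<forall>a\<in>?J. \<forall>t\<in>{0..a}. Q t)" for Q
  proof
    assume "\<forall>t. 0 \<le> t \<and> ereal t < t\<^sub>e \<longrightarrow> Q t"
    then show "\<forall>a\<in>?J. \<forall>t\<in>{0..a}. Q t" using J by blast
  next
    assume Q: "\<forall>a\<in>?J. \<forall>t\<in>{0..a}. Q t"
    show "\<forall>t. 0 \<le> t \<and> ereal t < t\<^sub>e \<longrightarrow> Q t"
    proof (intro allI impI)
      fix t assume t: "0 \<le> t \<and> ereal t < t\<^sub>e"
      then show "Q t" using bspec[OF Q, of t] by simp
    qed
  qed
  ultimately show ?thesis by (simp only: J_ball)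
qed

end
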